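(* Let $d\ge2$, $Y=[0,1]^d$, and $u\in C^3(\mathbb R^d)$ such that $\nabla u$ is $Y$-periodic. Let $X$ be the gradient flow $\partial_tX(t,x)=\nabla u(X(t,x))$, $X(0,x)=x$, and assume that for almost every $x\in\mathbb R^d$, the set $\{X(t,x):t\ge0\}$ or the set $\{X(t,x):t\le0\}$ is bounded in $\mathbb R^d$. (i) Assume that $\Delta u(x)=0$ for every $x\in\mathbb R^d$ with $\nabla u(x)=0$, and that there is a constant $C>0$ with $$\Big|\int_0^t\Delta u\big(X(s,x)\big)\,ds\Big|\le C\quad\text{for all } t\ge0,\ x\in\mathbb R^d.$$ Then there exists a positive $Y$-periodic function $\sigma$ with $\sigma,\sigma^{-1}\in L^\infty(\mathbb R^d)$ such that $\mathrm{div}(\sigma\nabla u)=0$ in the sense of distributions on $\mathbb R^d$. (ii) Conversely, if there is a positive $Y$-periodic $\sigma\in C^1(\mathbb R^d)$ with $\mathrm{div}(\sigma\nabla u)=0$ in $\mathbb R^d$, then $\Delta u(x)=0$ at every critical point $x$ of $u$, and there is $C>0$ with $\big|\int_0^t\Delta u(X(s,x))\,ds\big|\le C$ for all $t\ge0$, $x\in\mathbb R^d$. *)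

theory Defs
  imports "HOL-Analysis.Analysis"
begin

definition partial :: "'n::finite \<Rightarrow> (real^'n \<Rightarrow> real) \<Rightarrow> real^'n \<Rightarrow> real" where
  "partial i f x = frechet_derivative f (at x) (axis i 1)"

fun Ck :: "nat \<Rightarrow> (real^'n::finite \<Rightarrow> real) \<Rightarrow> bool" where
  "Ck 0 f = continuous_on UNIV f"
| "Ck (Suc k) f = ((\<forall>x. f differentiable (at x)) \<and> (\<forall>i. Ck k (partial i f)))"

definition smooth :: "(real^'n::finite \<Rightarrow> real) \<Rightarrow> bool" where
  "smooth f = (\<forall>k. Ck k f)"

definition test_function :: "(real^'n::finite \<Rightarrow> real) \<Rightarrow> bool" where
  "test_function \<phi> = (smooth \<phi> \<and> compact (closure {x. \<phi> x \<noteq> 0}))"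

definition grad :: "(real^'n::finite \<Rightarrow> real) \<Rightarrow> real^'n \<Rightarrow> real^'n" where
  "grad f x = (\<chi> i. partial i f x)"

definition laplacian :: "(real^'n::finite \<Rightarrow> real) \<Rightarrow> real^'n \<Rightarrow> real" where
  "laplacian f x = (\<Sum>i\<in>UNIV. partial i (partial i f) x)"

definition divergence :: "(real^'n::finite \<Rightarrow> real^'n) \<Rightarrow> real^'n \<Rightarrow> real" where
  "divergence F x = (\<Sum>i\<in>UNIV. partial i (\<lambda>y. F y $ i) x)"

definition Y_periodic :: "(real^'n::finite \<Rightarrow> 'b) \<Rightarrow> bool" where
  "Y_periodic f = (\<forall>x i. f (x + axis i 1) = f x)"

definition div_free_distrib :: "(real^'n::finite \<Rightarrow> real) \<Rightarrow> (real^'n \<Rightarrow> real) \<Rightarrow> bool" where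
  "div_free_distrib \<sigma> u =
     (\<forall>\<phi>. test_function \<phi> \<longrightarrow> (\<integral>x. \<sigma> x * (grad u x \<bullet> grad \<phi> x) \<partial>lborel) = 0)"

end

theory Submission
  imports Defs
begin

text \<open>
  Write \<open>S t x\<close> for the integral of \<open>\<Delta>u\<close> along the trajectory of \<open>x\<close> up to time \<open>t\<close>. Solving
  \<open>div (\<sigma> \<nabla>u) = 0\<close> amounts to \<open>\<sigma> (X t x) = \<sigma> x * exp (- S t x)\<close>. If \<open>S\<close> is bounded, the cocycle
  identity \<open>S (s + t) x = S s (X t x) + S t x\<close> shows that \<open>\<sigma> x = exp (limsup S t x)\<close>, with \<open>t\<close> tending to
  infinity, has this property. By Liouville's theorem \<open>X t\<close> maps the measure \<open>exp (S t x) dx\<close> to \<open>dx\<close>,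
  so the integral of \<open>\<sigma> * (\<phi> \<circ> X t)\<close> does not depend on \<open>t\<close>; differentiating at \<open>t = 0\<close> gives the weak
  equation. Conversely, a \<open>C\<^sup>1\<close> solution makes \<open>ln \<sigma>\<close> a bounded primitive of \<open>- \<Delta>u\<close> along trajectories.

  Liouville's theorem is obtained without differentiating the flow in the initial point: with
  \<open>P t g x = exp (S t x) * g (X t x)\<close>, the integrals of \<open>P h g\<close> and \<open>g\<close> differ by \<open>O(h\<^sup>2)\<close> for Lipschitz
  \<open>g\<close> of bounded support, by the change of variables \<open>x + h b x\<close>; since \<open>P t\<close> preserves this class of
  functions, the integral of \<open>P t g\<close> has derivative zero in \<open>t\<close>.
\<close>

section \<open>Determinants near the identity\<close>

text \<open>Everything beyond the linear part of the expanded product carries at least two factors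
  \<open>h\<close>. The quantifier order matters: \<open>C\<close> depends only on \<open>S\<close>
  and \<open>K\<close>, so the bound is uniform over families \<open>a\<close> that vary from point
  to point.\<close>

lemma prod_one_plus_second_order:
  fixes S :: "'a set" and K :: real
  assumes "finite S" "0 \<le> K"
  shows "\<exists>C\<ge>0. \<forall>a h. (\<forall>i\<in>S. \<bar>a i\<bar> \<le> K) \<longrightarrow> \<bar>h\<bar> \<le> 1 \<longrightarrow>
    \<bar>(\<Prod>i\<in>S. 1 + h * a i) - 1 - h * (\<Sum>i\<in>S. a i)\<bar> \<le> C * h\<^sup>2"
  using assms
proof (induction S rule: finite_induct)
  case empty
  then show ?case by (auto intro!: exI[of _ 0])
next
  case (insert j S)
  then obtain C where C: "C \<ge> 0" and
    bound: "\<And>a h. (\<forall>i\<in>S. \<bar>a i\<bar> \<le> K) \<Longrightarrow> \<bar>h\<bar> \<le> 1 \<Longrightarrow>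
      \<bar>(\<Prod>i\<in>S. 1 + h * a i) - 1 - h * (\<Sum>i\<in>S. a i)\<bar> \<le> C * h\<^sup>2"
    by blast
  have "\<bar>(\<Prod>i\<in>insert j S. 1 + h * a i) - 1 - h * (\<Sum>i\<in>insert j S. a i)\<bar>
      \<le> (K * (card S * K) + (1 + K) * C) * h\<^sup>2"
    if a: "\<forall>i\<in>insert j S. \<bar>a i\<bar> \<le> K" and h: "\<bar>h\<bar> \<le> 1" for a :: "'a \<Rightarrow> real" and h :: real
  proof -
    define s where "s = (\<Sum>i\<in>S. a i)"
    define r where "r = (\<Prod>i\<in>S. 1 + h * a i) - 1 - h * s"
    have r: "\<bar>r\<bar> \<le> C * h\<^sup>2"
      unfolding r_def s_def using a h by (intro bound) auto
    have s: "\<bar>s\<bar> \<le> card S * K"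
      unfolding s_def using a by (intro order_trans[OF sum_abs] sum_bounded_above) auto
    have "\<bar>h * a j\<bar> \<le> 1 * K"
      unfolding abs_mult using a h by (intro mult_mono) auto
    then have ha: "\<bar>1 + h * a j\<bar> \<le> 1 + K" by linarith
    \<comment> \<open>The new remainder consists of the product of the two linear terms and the old
      remainder times the new factor; the constant claimed above adds the bounds for these
      two.\<close>
    have "(\<Prod>i\<in>insert j S. 1 + h * a i) - 1 - h * (\<Sum>i\<in>insert j S. a i)
        = h\<^sup>2 * (a j * s) + (1 + h * a j) * r"
      using insert.hyps by (simp add: r_def s_def algebra_simps power2_eq_square)
    also have "\<bar>\<dots>\<bar> \<le> h\<^sup>2 * (\<bar>a j\<bar> * \<bar>s\<bar>) + \<bar>1 + h * a j\<bar> * \<bar>r\<bar>"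
      by (rule order_trans[OF abs_triangle_ineq]) (simp add: abs_mult)
    also have "\<dots> \<le> h\<^sup>2 * (K * (card S * K)) + (1 + K) * (C * h\<^sup>2)"
      using a s r ha insert.prems C by (intro add_mono mult_left_mono mult_mono) auto
    finally show ?thesis by (simp add: algebra_simps)
  qed
  then show ?case
    using C insert.prems by (intro exI[of _ "K * (card S * K) + (1 + K) * C"]) auto
qed

text \<open>In the Leibniz expansion the identity permutation contributes the diagonal product,
  handled by the previous lemma. Any other permutation moves at least two indices, so its term has
  two off-diagonal factors, each of order \<open>h\<close>.\<close>

lemma det_second_order:
  fixes K :: real
  assumes "0 \<le> K"
  shows "\<exists>C\<ge>0. \<forall>(A :: real^'m^'m) h. (\<forall>i j. \<bar>A $ i $ j\<bar> \<le> K) \<longrightarrow> \<bar>h\<bar> \<le> 1 \<longrightarrow>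
    \<bar>det (mat 1 + h *\<^sub>R A) - 1 - h * (\<Sum>i\<in>UNIV. A $ i $ i)\<bar> \<le> C * h\<^sup>2"
proof -
  obtain C where C: "C \<ge> 0" and
    bound: "\<And>a h. (\<forall>i\<in>(UNIV :: 'm set). \<bar>a i\<bar> \<le> K) \<Longrightarrow> \<bar>h\<bar> \<le> 1 \<Longrightarrow>
      \<bar>(\<Prod>i\<in>UNIV. 1 + h * a i) - 1 - h * (\<Sum>i\<in>UNIV. a i)\<bar> \<le> C * h\<^sup>2"
    using prod_one_plus_second_order[of "UNIV :: 'm set" K] assms by auto
  define P where "P = {p. p permutes (UNIV :: 'm set)}"
  \<comment> \<open>\<open>K * K\<close> accounts for two off-diagonal entries after
    \<open>h\<close> has been taken out of each; the remaining factors are at most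
    \<open>1 + K\<close>, and since \<open>1 + K \<ge> 1\<close> their number may be raised to
    \<open>CARD('m)\<close>.\<close>
  define B where "B = K * K * (1 + K) ^ CARD('m)"
  have B: "B \<ge> 0" using assms by (simp add: B_def)
  have finP: "finite P" and idP: "id \<in> P"
    by (auto simp: P_def permutes_id)
  have "\<bar>det (mat 1 + h *\<^sub>R A) - 1 - h * (\<Sum>i\<in>UNIV. A $ i $ i)\<bar> \<le> (C + card P * B) * h\<^sup>2"
    if A: "\<forall>i j. \<bar>A $ i $ j\<bar> \<le> K" and h: "\<bar>h\<bar> \<le> 1" for A :: "real^'m^'m" and h
  proof -
    let ?M = "mat 1 + h *\<^sub>R A"
    define T where "T p = of_int (sign p) * (\<Prod>i\<in>UNIV. ?M $ i $ p i)" for p :: "'m \<Rightarrow> 'm"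
    have hA: "\<bar>h * A $ i $ j\<bar> \<le> K" for i j
    proof -
      have "\<bar>h\<bar> * \<bar>A $ i $ j\<bar> \<le> 1 * K" using A h by (intro mult_mono) auto
      then show ?thesis by (simp add: abs_mult)
    qed
    have M: "\<bar>?M $ i $ j\<bar> \<le> 1 + K" for i j
      using hA[of i j] by (auto simp: mat_def)
    have T: "\<bar>T p\<bar> \<le> B * h\<^sup>2" if "p \<in> P - {id}" for p
    proof -
      from that have p: "p permutes UNIV" and "p \<noteq> id" by (auto simp: P_def)
      then obtain i where i: "p i \<noteq> i" by (auto simp: fun_eq_iff)
      \<comment> \<open>By injectivity \<open>p i\<close> is moved as well, which supplies the
        second off-diagonal factor.\<close>
      with p have j: "p (p i) \<noteq> p i" by (metis permutes_inverses(2))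
      have "(\<Prod>k\<in>UNIV. \<bar>?M $ k $ p k\<bar>)
          = \<bar>?M $ i $ p i\<bar> * (\<bar>?M $ p i $ p (p i)\<bar> * (\<Prod>k\<in>UNIV - {i} - {p i}. \<bar>?M $ k $ p k\<bar>))"
        using i by (subst prod.remove[of _ i], simp, simp, subst prod.remove[of _ "p i"]) auto
      also have "\<dots> = h\<^sup>2 * (\<bar>A $ i $ p i\<bar> * \<bar>A $ p i $ p (p i)\<bar> * (\<Prod>k\<in>UNIV - {i} - {p i}. \<bar>?M $ k $ p k\<bar>))"
      proof -
        have "\<bar>?M $ i $ p i\<bar> = \<bar>h\<bar> * \<bar>A $ i $ p i\<bar>" "\<bar>?M $ p i $ p (p i)\<bar> = \<bar>h\<bar> * \<bar>A $ p i $ p (p i)\<bar>"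
          using i j by (auto simp: mat_def abs_mult)
        moreover have "h\<^sup>2 = \<bar>h\<bar> * \<bar>h\<bar>" by (simp add: power2_eq_square)
        ultimately show ?thesis by (simp only: mult_ac)
      qed
      also have "\<dots> \<le> h\<^sup>2 * (K * K * (1 + K) ^ CARD('m))"
      proof -
        have "(\<Prod>k\<in>UNIV - {i} - {p i}. \<bar>?M $ k $ p k\<bar>) \<le> (\<Prod>k\<in>UNIV - {i} - {p i}. 1 + K)"
          using M by (intro prod_mono) auto
        also have "\<dots> = (1 + K) ^ card (UNIV - {i} - {p i})" by simp
        also have "\<dots> \<le> (1 + K) ^ CARD('m)"
          using assms by (intro power_increasing card_mono) auto
        finally show ?thesis
          using A assms by (intro mult_left_mono mult_mono) (auto intro!: prod_nonneg)
      qed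
      finally have "(\<Prod>k\<in>UNIV. \<bar>?M $ k $ p k\<bar>) \<le> B * h\<^sup>2" by (simp add: B_def mult.commute)
      moreover have "\<bar>T p\<bar> = (\<Prod>k\<in>UNIV. \<bar>?M $ k $ p k\<bar>)"
        by (simp add: T_def abs_mult abs_prod sign_def)
      ultimately show ?thesis by simp
    qed
    have "det ?M = T id + (\<Sum>p\<in>P - {id}. T p)"
      unfolding det_def P_def[symmetric] T_def[symmetric] using finP idP by (rule sum.remove)
    moreover have "T id = (\<Prod>i\<in>UNIV. 1 + h * A $ i $ i)"
      by (simp add: T_def mat_def)
    ultimately have "\<bar>det ?M - 1 - h * (\<Sum>i\<in>UNIV. A $ i $ i)\<bar>
        \<le> \<bar>(\<Prod>i\<in>UNIV. 1 + h * A $ i $ i) - 1 - h * (\<Sum>i\<in>UNIV. A $ i $ i)\<bar> + \<bar>\<Sum>p\<in>P - {id}. T p\<bar>"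
      by linarith
    also have "\<dots> \<le> C * h\<^sup>2 + card (P - {id}) * (B * h\<^sup>2)"
      using A h T by (intro add_mono bound order_trans[OF sum_abs] sum_bounded_above) auto
    also have "\<dots> \<le> C * h\<^sup>2 + card P * (B * h\<^sup>2)"
      using finP B by (intro add_left_mono mult_right_mono) (auto intro: card_mono)
    finally show ?thesis by (simp add: algebra_simps)
  qed
  then show ?thesis
    using C B by (intro exI[of _ "C + card P * B"]) auto
qed

section \<open>Change of variables for an Euler step\<close>

text \<open>
  The change of variables theorem of the library requires the index type to be well-ordered. Every
  finite type has a well-ordered copy.
\<close>

typedef 'a ordered = "UNIV :: 'a set" ..

instance ordered :: (finite) finite
proof
  have "(UNIV :: 'a ordered set) = Abs_ordered ` UNIV"
    by (metis Rep_ordered_inverse surj_def)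
  then show "finite (UNIV :: 'a ordered set)"
    by (metis finite_imageI finite)
qed

instantiation ordered :: (finite) wellorder
begin

definition "x \<le> y \<longleftrightarrow> to_nat (Rep_ordered x) \<le> to_nat (Rep_ordered y)"
definition "x < y \<longleftrightarrow> to_nat (Rep_ordered x) < to_nat (Rep_ordered y)"

instance
proof
  fix P :: "'a ordered \<Rightarrow> bool" and a
  assume step: "\<And>x. (\<And>y. y < x \<Longrightarrow> P y) \<Longrightarrow> P x"
  show "P a"
  proof (induction a rule: measure_induct_rule[of "\<lambda>x. to_nat (Rep_ordered x)"])
    case (less x)
    show ?case by (rule step, rule less.IH) (simp only: less_ordered_def)
  qed
qed (auto simp: less_eq_ordered_def less_ordered_def Rep_ordered_inject)

end

section \<open>Coordinates indexed by the well-ordered copy\<close>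

lemma bij_Abs_ordered: "bij Abs_ordered"
  by (metis Abs_ordered_inverse Rep_ordered_inverse UNIV_I bijI')

definition to_ordered :: "real^'n \<Rightarrow> real^('n ordered)" where
  "to_ordered x = (\<chi> i. x $ Rep_ordered i)"

definition of_ordered :: "real^('n ordered) \<Rightarrow> real^'n" where
  "of_ordered x = (\<chi> i. x $ Abs_ordered i)"

lemma of_to_ordered [simp]: "of_ordered (to_ordered x) = x"
  by (simp add: of_ordered_def to_ordered_def Abs_ordered_inverse)

lemma inner_of_ordered [simp]: "of_ordered x \<bullet> of_ordered y = x \<bullet> y"
  unfolding inner_vec_def of_ordered_def
  using sum.reindex_bij_betw[OF bij_Abs_ordered, of "\<lambda>i. x $ i \<bullet> y $ i"] by simp

lemma linear_of_ordered: "linear of_ordered"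
  by (auto intro!: linearI simp: of_ordered_def vec_eq_iff)

lemma linear_to_ordered: "linear to_ordered"
  by (auto intro!: linearI simp: to_ordered_def vec_eq_iff)

lemma norm_of_ordered [simp]: "norm (of_ordered x) = norm x"
  by (simp add: norm_eq_sqrt_inner)

lemma norm_to_ordered [simp]: "norm (to_ordered x) = norm x"
  by (metis norm_of_ordered of_to_ordered)

lemma bounded_linear_of_ordered: "bounded_linear of_ordered"
  using linear_of_ordered linear_conv_bounded_linear by blast

lemma bounded_linear_to_ordered: "bounded_linear to_ordered"
  using linear_to_ordered linear_conv_bounded_linear by blast

lemma prod_inner_Basis_cart:
  fixes x :: "real^'n"
  shows "(\<Prod>b\<in>Basis. x \<bullet> b) = (\<Prod>i\<in>UNIV. x $ i)"
proof -
  have Basis: "(Basis :: (real^'n) set) = (\<lambda>i. axis i 1) ` UNIV"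
    by (auto simp: Basis_vec_def)
  have inj: "inj (\<lambda>i. axis i (1::real) :: real^'n)"
    by (auto simp: inj_def axis_eq_axis)
  show ?thesis
    unfolding Basis by (simp add: prod.reindex[OF inj] inner_axis)
qed

text \<open>Lebesgue measure is characterised by its values on boxes, and relabelling coordinates
  carries boxes to boxes with the same side lengths.\<close>

lemma lborel_distr_of_ordered:
  "distr lborel borel of_ordered = (lborel :: (real^'n) measure)"
proof (rule lborel_eqI[symmetric])
  fix l u :: "real^'n"
  assume lu: "\<And>b. b \<in> Basis \<Longrightarrow> l \<bullet> b \<le> u \<bullet> b"
  have lu': "l $ i \<le> u $ i" for i
    using lu[of "axis i 1"] by (auto simp: Basis_vec_def inner_axis)
  have "of_ordered -` box l u = box (to_ordered l) (to_ordered u)"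
    unfolding mem_box_cart set_eq_iff vimage_def of_ordered_def to_ordered_def mem_Collect_eq vec_lambda_beta
    by (metis Abs_ordered_inverse Rep_ordered_inverse UNIV_I)
  then have "emeasure (distr lborel borel of_ordered) (box l u)
      = emeasure lborel (box (to_ordered l) (to_ordered u))"
    using linear_continuous_on[OF bounded_linear_of_ordered]
    by (subst emeasure_distr) (auto intro: borel_measurable_continuous_onI)
  also have "\<dots> = (\<Prod>b\<in>Basis. (to_ordered u - to_ordered l) \<bullet> b)"
    using lu' by (subst emeasure_lborel_box) (auto simp: Basis_vec_def inner_axis to_ordered_def)
  also have "(\<Prod>b\<in>Basis. (to_ordered u - to_ordered l) \<bullet> b) = (\<Prod>b\<in>Basis. (u - l) \<bullet> b)"
    unfolding prod_inner_Basis_cart to_ordered_def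
    using prod.reindex_bij_betw[OF bij_Abs_ordered, of "\<lambda>i. u $ Rep_ordered i - l $ Rep_ordered i"]
    by (simp add: Abs_ordered_inverse)
  finally show "emeasure (distr lborel borel of_ordered) (box l u) = (\<Prod>b\<in>Basis. (u - l) \<bullet> b)" .
qed simp

section \<open>Continuous functions of bounded support\<close>

lemma integrable_continuous_bounded_support:
  fixes f :: "'a::euclidean_space \<Rightarrow> 'b::{banach,second_countable_topology}"
  assumes "continuous_on UNIV f" "\<And>x. norm x > R \<Longrightarrow> f x = 0"
  shows "integrable lborel f"
proof -
  have "integrable lborel (\<lambda>x. indicator (cball 0 R) x *\<^sub>R f x)"
    by (rule borel_integrable_compact) (auto intro: continuous_on_subset[OF assms(1)])
  moreover have "(\<lambda>x. indicator (cball 0 R) x *\<^sub>R f x) = f"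
    using assms(2) by (auto simp: indicator_def fun_eq_iff not_le)
  ultimately show ?thesis by simp
qed

lemma bounded_continuous_bounded_support:
  fixes f :: "'a::euclidean_space \<Rightarrow> 'b::real_normed_vector"
  assumes "continuous_on UNIV f" "\<And>x. norm x > R \<Longrightarrow> f x = 0"
  obtains B where "B \<ge> 0" "\<And>x. norm (f x) \<le> B"
proof -
  have "compact (f ` cball 0 R)"
    by (intro compact_continuous_image compact_cball continuous_on_subset[OF assms(1)]) auto
  then obtain B where B: "\<And>x. norm x \<le> R \<Longrightarrow> norm (f x) \<le> B"
    by (force dest!: compact_imp_bounded simp: bounded_iff)
  have "norm (f x) \<le> max B 0" for x
    using B[of x] assms(2)[of x] by (cases "norm x \<le> R") (auto simp: not_le)
  then show ?thesis using that[of "max B 0"] by auto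
qed

text \<open>Solving \<open>x + h *\<^sub>R b x = y\<close> means finding a fixed point of
  \<open>x \<mapsto> y - h *\<^sub>R b x\<close>, a contraction with factor
  \<open>\<bar>h\<bar> * L\<close>; Banach's theorem gives existence and uniqueness at once.\<close>

lemma perturbed_identity_bij:
  fixes b :: "'a::{banach,heine_borel} \<Rightarrow> 'a"
  assumes lip: "\<And>x y. norm (b x - b y) \<le> L * norm (x - y)" and "0 \<le> L" "\<bar>h\<bar> * L < 1"
  shows "bij (\<lambda>x. x + h *\<^sub>R b x)"
proof -
  have "\<exists>!x. x + h *\<^sub>R b x = y" for y
  proof -
    have "dist (y - h *\<^sub>R b u) (y - h *\<^sub>R b v) \<le> (\<bar>h\<bar> * L) * dist u v" for u v
    proof -
      have "dist (y - h *\<^sub>R b u) (y - h *\<^sub>R b v) = \<bar>h\<bar> * norm (b u - b v)"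
        by (simp add: dist_norm norm_minus_commute flip: scaleR_diff_right)
      also have "\<dots> \<le> \<bar>h\<bar> * (L * norm (u - v))"
        by (intro mult_left_mono lip) auto
      finally show ?thesis by (simp add: dist_norm)
    qed
    then have "\<exists>!x. y - h *\<^sub>R b x = x"
      using assms by (intro banach_fix_type[of "\<bar>h\<bar> * L"]) auto
    moreover have "y - h *\<^sub>R b x = x \<longleftrightarrow> x + h *\<^sub>R b x = y" for x
      by (auto simp: algebra_simps)
    ultimately show ?thesis by simp
  qed
  then show ?thesis by (auto simp: bij_iff)
qed

text \<open>With the true Jacobian determinant the change of variables is exact; replacing the
  determinant by \<open>1 + h\<close> times the divergence costs \<open>O(h\<^sup>2)\<close> on a
  fixed ball. The condition \<open>\<bar>h\<bar> * (CARD('m) * L) < 1\<close> serves twice: it makes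
  the Euler step bijective and keeps the linearised determinant nonnegative.\<close>

lemma euler_step_integral_wellorder:
  fixes b :: "real^'m::{finite,wellorder} \<Rightarrow> real^'m::_" and L :: real
  assumes der: "\<And>x. (b has_derivative D x) (at x)"
    and D: "\<And>x v. norm (D x v) \<le> L * norm v" and L: "0 \<le> L"
    and b_bdd: "\<And>x. norm (b x) \<le> M"
    and div_cont: "continuous_on UNIV (\<lambda>x. \<Sum>i\<in>UNIV. D x (axis i 1) $ i)"
    and g_cont: "continuous_on UNIV g" and g_supp: "\<And>x. norm x > R \<Longrightarrow> g x = (0::real)"
  shows "\<exists>C. \<forall>h. \<bar>h\<bar> \<le> 1 \<longrightarrow> \<bar>h\<bar> * (CARD('m) * L) < 1 \<longrightarrow>
    \<bar>(\<integral>x. g (x + h *\<^sub>R b x) * (1 + h * (\<Sum>i\<in>UNIV. D x (axis i 1) $ i)) \<partial>lborel) - (\<integral>x. g x \<partial>lborel)\<bar>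
      \<le> C * h\<^sup>2"
proof -
  define d where "d x = (\<Sum>i\<in>UNIV. D x (axis i 1) $ i)" for x
  have lip: "norm (b x - b y) \<le> L * norm (x - y)" for x y
  proof (rule differentiable_bound[of UNIV b D])
    show "onorm (D z) \<le> L" for z
      using D L by (intro onorm_bound) auto
  qed (use der in auto)
  have b_cont: "continuous_on UNIV b"
    using der by (meson has_derivative_continuous continuous_at_imp_continuous_on)
  obtain B where B: "B \<ge> 0" "\<And>x. \<bar>g x\<bar> \<le> B"
    using bounded_continuous_bounded_support[OF g_cont g_supp] by auto
  obtain C where C: "C \<ge> 0" and det: "\<And>(A :: real^'m::_^'m::_) h. (\<forall>i j. \<bar>A $ i $ j\<bar> \<le> L) \<Longrightarrow> \<bar>h\<bar> \<le> 1 \<Longrightarrow>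
      \<bar>det (mat 1 + h *\<^sub>R A) - 1 - h * (\<Sum>i\<in>UNIV. A $ i $ i)\<bar> \<le> C * h\<^sup>2"
    using det_second_order[OF L] by blast
  \<comment> \<open>For \<open>\<bar>h\<bar> \<le> 1\<close> the Euler step displaces points by at
    most \<open>M\<close>, so this ball contains the support of every integrand that occurs,
    independently of \<open>h\<close>.\<close>
  let ?K = "cball (0 :: real^'m::_) (R + M)"
  have "\<bar>(\<integral>x. g (x + h *\<^sub>R b x) * (1 + h * d x) \<partial>lborel) - (\<integral>x. g x \<partial>lborel)\<bar>
      \<le> (B * C * measure lborel ?K) * h\<^sup>2"
    if h: "\<bar>h\<bar> \<le> 1" "\<bar>h\<bar> * (CARD('m) * L) < 1" for h
  proof -
    have "1 * (\<bar>h\<bar> * L) \<le> CARD('m) * (\<bar>h\<bar> * L)"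
      using L by (intro mult_right_mono) (auto simp: Suc_le_eq)
    then have hL: "\<bar>h\<bar> * L < 1"
      using h(2) by (simp add: mult.left_commute)
    define E where "E x = x + h *\<^sub>R b x" for x
    define A where "A x = matrix (D x)" for x
    have bij: "bij E"
      unfolding E_def using perturbed_identity_bij[OF lip L hL] .
    have E_der: "(E has_derivative (\<lambda>v. v + h *\<^sub>R D x v)) (at x)" for x
      unfolding E_def using der by (auto intro!: derivative_eq_intros)
    have lin: "linear (D x)" for x
      using der has_derivative_linear by blast
    have matE: "matrix (\<lambda>v. v + h *\<^sub>R D x v) = mat 1 + h *\<^sub>R A x" for x
      by (auto simp: matrix_def mat_def vec_eq_iff A_def axis_def)
    have entries: "\<bar>A x $ i $ j\<bar> \<le> L" for x i j
    proof -
      have "\<bar>D x (axis j 1) $ i\<bar> \<le> norm (D x (axis j 1))"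
        by (rule component_le_norm_cart)
      also have "\<dots> \<le> L" using D[of x "axis j 1"] by simp
      finally show ?thesis by (simp add: A_def matrix_def)
    qed
    have tr: "(\<Sum>i\<in>UNIV. A x $ i $ i) = d x" for x
      by (simp add: A_def d_def matrix_def)
    have E_supp: "g (E x) = 0" if "x \<notin> ?K" for x
    proof (rule g_supp)
      have "norm (h *\<^sub>R b x) \<le> 1 * M"
        unfolding norm_scaleR using h b_bdd by (intro mult_mono) auto
      moreover have "norm x \<le> norm (E x) + norm (h *\<^sub>R b x)"
        unfolding E_def by (metis add_diff_cancel norm_triangle_ineq4)
      ultimately show "R < norm (E x)" using that by simp
    qed
    have E_cont: "continuous_on UNIV E"
      unfolding E_def by (intro continuous_intros b_cont)
    have gE_cont: "continuous_on UNIV (\<lambda>x. g (E x))"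
      by (rule continuous_on_compose2[OF g_cont E_cont]) auto
    have 1: "((\<lambda>x. g (E x) * (1 + h * d x)) has_integral (\<integral>x. g (E x) * (1 + h * d x) \<partial>lborel)) UNIV"
      using E_supp div_cont
      by (intro has_integral_integral_lborel integrable_continuous_bounded_support[of _ "R + M"])
        (auto intro!: continuous_intros gE_cont simp: d_def)
    have 2: "((\<lambda>x. \<bar>det (mat 1 + h *\<^sub>R A x)\<bar> * g (E x)) has_integral (\<integral>x. g x \<partial>lborel)) UNIV"
    proof -
      \<comment> \<open>The change of variables theorem is applied to functions with values in a
        Euclidean space \<open>real^_\<close>; \<open>g\<close> therefore travels as a function into
        \<open>real^1\<close>, and its integral is recovered by projecting to component 1.\<close>
      define f where "f x = (vec (g x) :: real^1)" for x
      have f_cont: "continuous_on UNIV f"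
        unfolding f_def vec_def by (intro continuous_on_vec_lambda g_cont)
      have f_int: "integrable lborel f"
        using f_cont g_supp by (intro integrable_continuous_bounded_support[of _ R]) (auto simp: f_def vec_eq_iff)
      then have "integrable lebesgue f"
        by (simp add: integrable_completion borel_measurable_continuous_onI[OF f_cont])
      then have "f absolutely_integrable_on UNIV"
        by (simp add: set_integrable_def)
      moreover have "E ` UNIV = UNIV" "inj_on E UNIV"
        using bij by (auto simp: bij_def)
      ultimately have *: "(\<lambda>x. \<bar>det (matrix (\<lambda>v. v + h *\<^sub>R D x v))\<bar> *\<^sub>R f (E x)) absolutely_integrable_on UNIV \<and>
           integral UNIV (\<lambda>x. \<bar>det (matrix (\<lambda>v. v + h *\<^sub>R D x v))\<bar> *\<^sub>R f (E x)) = integral UNIV f"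
        using has_absolute_integral_change_of_variables[of UNIV E "\<lambda>x v. v + h *\<^sub>R D x v" f "integral UNIV f"] E_der
        by simp
      then have "((\<lambda>x. \<bar>det (matrix (\<lambda>v. v + h *\<^sub>R D x v))\<bar> *\<^sub>R f (E x)) has_integral integral UNIV f) UNIV"
        using set_lebesgue_integral_eq_integral(1) integrable_integral by fastforce
      then have "((\<lambda>y. y $ 1) \<circ> (\<lambda>x. \<bar>det (matrix (\<lambda>v. v + h *\<^sub>R D x v))\<bar> *\<^sub>R f (E x)) has_integral integral UNIV f $ 1) UNIV"
        by (rule has_integral_linear) (rule bounded_linear_vec_nth)
      moreover have "integral UNIV f $ 1 = (\<integral>x. g x \<partial>lborel)"
      proof -
        have "((\<lambda>y. y $ 1) \<circ> f has_integral integral UNIV f $ 1) UNIV"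
          using f_int
          by (intro has_integral_linear[OF _ bounded_linear_vec_nth] integrable_integral integrable_on_lborel)
        then have "(g has_integral integral UNIV f $ 1) UNIV"
          by (simp add: f_def o_def)
        moreover have "(g has_integral (\<integral>x. g x \<partial>lborel)) UNIV"
          using g_cont g_supp
          by (intro has_integral_integral_lborel integrable_continuous_bounded_support) auto
        ultimately show ?thesis by (rule has_integral_unique)
      qed
      ultimately show ?thesis by (simp add: f_def o_def matE)
    qed
    have d_pos: "0 \<le> 1 + h * d x" for x
    proof -
      have "\<bar>d x\<bar> \<le> CARD('m) * L"
        unfolding tr[symmetric] using entries by (intro order_trans[OF sum_abs] sum_bounded_above) auto
      then have "\<bar>h * d x\<bar> \<le> \<bar>h\<bar> * (CARD('m) * L)"
        unfolding abs_mult by (intro mult_left_mono) auto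
      with h show ?thesis by linarith
    qed
    have pointwise: "norm (g (E x) * (1 + h * d x) - \<bar>det (mat 1 + h *\<^sub>R A x)\<bar> * g (E x))
        \<le> (if x \<in> ?K then B * (C * h\<^sup>2) else 0)" for x
    proof (cases "x \<in> ?K")
      case True
      \<comment> \<open>As \<open>1 + h * d x\<close> is nonnegative, it equals its own absolute
        value, and the reverse triangle inequality removes the absolute value around the
        determinant.\<close>
      have "\<bar>(1 + h * d x) - \<bar>det (mat 1 + h *\<^sub>R A x)\<bar>\<bar> \<le> C * h\<^sup>2"
        using det[of "A x" h] entries h d_pos[of x] unfolding tr by force
      then have "\<bar>g (E x)\<bar> * \<bar>(1 + h * d x) - \<bar>det (mat 1 + h *\<^sub>R A x)\<bar>\<bar> \<le> B * (C * h\<^sup>2)"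
        using B by (intro mult_mono) auto
      moreover have "g (E x) * (1 + h * d x) - \<bar>det (mat 1 + h *\<^sub>R A x)\<bar> * g (E x)
          = g (E x) * ((1 + h * d x) - \<bar>det (mat 1 + h *\<^sub>R A x)\<bar>)"
        by (simp add: algebra_simps)
      ultimately show ?thesis using True by (simp only: real_norm_def abs_mult if_True)
    qed (simp add: E_supp)
    have const: "((\<lambda>x. if x \<in> ?K then B * (C * h\<^sup>2) else 0) has_integral
        measure lborel ?K * (B * (C * h\<^sup>2))) UNIV"
      unfolding has_integral_restrict_UNIV
      using has_integral_mult_left[OF has_integral_measure_lborel[OF _ emeasure_lborel_cball_finite],
          of 0 "R + M" "B * (C * h\<^sup>2)"]
      by simp
    have "norm ((\<integral>x. g (E x) * (1 + h * d x) \<partial>lborel) - (\<integral>x. g x \<partial>lborel))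
        \<le> measure lborel ?K * (B * (C * h\<^sup>2))"
      using integral_norm_bound_integral[OF has_integral_integrable[OF has_integral_diff[OF 1 2]]
          has_integral_integrable[OF const] pointwise]
      unfolding integral_unique[OF has_integral_diff[OF 1 2]] integral_unique[OF const] .
    then show ?thesis by (simp add: E_def mult_ac)
  qed
  then show ?thesis unfolding d_def by blast
qed

text \<open>Conjugation with \<open>of_ordered\<close> reduces this to the well-ordered case: the
  map is a linear isometry preserving Lebesgue measure, and it permutes the coordinate axes, so the
  trace of the derivative is unchanged.\<close>

lemma euler_step_integral:
  fixes b :: "real^'n \<Rightarrow> real^'n" and L :: real
  assumes der: "\<And>x. (b has_derivative D x) (at x)"
    and D: "\<And>x v. norm (D x v) \<le> L * norm v" and L: "0 \<le> L"
    and b_bdd: "\<And>x. norm (b x) \<le> M"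
    and div_cont: "continuous_on UNIV (\<lambda>x. \<Sum>i\<in>UNIV. D x (axis i 1) $ i)"
    and g_cont: "continuous_on UNIV g" and g_supp: "\<And>x. norm x > R \<Longrightarrow> g x = (0::real)"
  shows "\<exists>C. \<forall>h. \<bar>h\<bar> \<le> 1 \<longrightarrow> \<bar>h\<bar> * (CARD('n) * L) < 1 \<longrightarrow>
    \<bar>(\<integral>x. g (x + h *\<^sub>R b x) * (1 + h * (\<Sum>i\<in>UNIV. D x (axis i 1) $ i)) \<partial>lborel) - (\<integral>x. g x \<partial>lborel)\<bar>
      \<le> C * h\<^sup>2"
proof -
  let ?P = "of_ordered :: real^('n ordered) \<Rightarrow> real^'n"
  have P_meas: "?P \<in> measurable lborel borel"
    using linear_continuous_on[OF bounded_linear_of_ordered] by (auto intro: borel_measurable_continuous_onI)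
  have P_cont: "continuous_on UNIV ?P"
    by (rule linear_continuous_on[OF bounded_linear_of_ordered])
  have card: "CARD('n ordered) = CARD('n)"
    by (rule bij_betw_same_card[OF bij_Abs_ordered, symmetric])
  have of_axis: "of_ordered (axis (Abs_ordered i) 1) = (axis i 1 :: real^'n)" for i
    by (auto simp: of_ordered_def axis_def vec_eq_iff Abs_ordered_inject)
  have tr: "(\<Sum>i\<in>UNIV. to_ordered (D (?P x) (?P (axis i 1))) $ i) = (\<Sum>i\<in>UNIV. D (?P x) (axis i 1) $ i)" for x
    using sum.reindex_bij_betw[OF bij_Abs_ordered, of "\<lambda>i. to_ordered (D (?P x) (?P (axis i 1))) $ i"]
    by (simp add: of_axis to_ordered_def Abs_ordered_inverse)
  have transfer: "(\<integral>x. F (?P x) \<partial>lborel) = (\<integral>x. F x \<partial>lborel)" if "continuous_on UNIV F" for F :: "real^'n \<Rightarrow> real"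
    using integral_distr[OF P_meas borel_measurable_continuous_onI[OF that]]
    by (simp add: lborel_distr_of_ordered)
  have b_cont: "continuous_on UNIV b"
    using der by (meson has_derivative_continuous continuous_at_imp_continuous_on)
  have step_cont: "continuous_on UNIV (\<lambda>x. g (x + h *\<^sub>R b x) * (1 + h * (\<Sum>i\<in>UNIV. D x (axis i 1) $ i)))" for h
    by (intro continuous_intros div_cont continuous_on_compose2[OF g_cont] b_cont) auto
  have "\<exists>C. \<forall>h. \<bar>h\<bar> \<le> 1 \<longrightarrow> \<bar>h\<bar> * (CARD('n ordered) * L) < 1 \<longrightarrow>
    \<bar>(\<integral>x. g (?P (x + h *\<^sub>R to_ordered (b (?P x)))) *
        (1 + h * (\<Sum>i\<in>UNIV. to_ordered (D (?P x) (?P (axis i 1))) $ i)) \<partial>lborel) - (\<integral>x. g (?P x) \<partial>lborel)\<bar>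
      \<le> C * h\<^sup>2"
  proof (rule euler_step_integral_wellorder[where R = R])
    have P_der: "(?P has_derivative ?P) (at x)" for x
      by (rule bounded_linear_imp_has_derivative[OF bounded_linear_of_ordered])
    show "((\<lambda>x. to_ordered (b (?P x))) has_derivative (\<lambda>v. to_ordered (D (?P x) (?P v)))) (at x)" for x
      by (intro bounded_linear.has_derivative[OF bounded_linear_to_ordered]
          has_derivative_compose[OF P_der der])
    show "norm (to_ordered (D (?P x) (?P v))) \<le> L * norm v" for x v
      using D[of "?P x" "?P v"] by simp
    show "continuous_on UNIV (\<lambda>x. \<Sum>i\<in>UNIV. to_ordered (D (?P x) (?P (axis i 1))) $ i)"
      unfolding tr by (rule continuous_on_compose2[OF div_cont P_cont]) auto
    show "continuous_on UNIV (\<lambda>x. g (?P x))"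
      by (rule continuous_on_compose2[OF g_cont P_cont]) auto
  qed (use L b_bdd g_supp in auto)
  moreover have "?P (x + h *\<^sub>R to_ordered y) = ?P x + h *\<^sub>R y" for x h y
    by (simp add: linear_add[OF linear_of_ordered] linear_cmul[OF linear_of_ordered])
  ultimately show ?thesis
    by (simp add: tr card transfer[OF g_cont] transfer[OF step_cont])
qed

section \<open>Differential and integral inequalities\<close>

text \<open>The mean value inequality on the symmetric interval from \<open>- \<bar>t\<bar>\<close>
  to \<open>\<bar>t\<bar>\<close>, which lets the flow estimates treat both signs of time
  together.\<close>

lemma increment_bound:
  fixes f :: "real \<Rightarrow> 'a::real_normed_vector"
  assumes "\<And>s. \<bar>s\<bar> \<le> \<bar>t\<bar> \<Longrightarrow> (f has_vector_derivative f' s) (at s)"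
    and "\<And>s. \<bar>s\<bar> \<le> \<bar>t\<bar> \<Longrightarrow> norm (f' s) \<le> B"
  shows "norm (f t - f 0) \<le> B * \<bar>t\<bar>"
proof -
  have "norm (f t - f 0) \<le> B * norm (t - 0)"
  proof (rule differentiable_bound[of "{-\<bar>t\<bar>..\<bar>t\<bar>}" f "\<lambda>s v. v *\<^sub>R f' s"])
    show "(f has_derivative (\<lambda>v. v *\<^sub>R f' s)) (at s within {-\<bar>t\<bar>..\<bar>t\<bar>})" if "s \<in> {-\<bar>t\<bar>..\<bar>t\<bar>}" for s
      using that assms(1)[of s] unfolding has_vector_derivative_def
      by (auto intro: has_derivative_at_withinI)
    have "0 \<le> B" using assms(2)[of 0] norm_ge_zero[of "f' 0"] by linarith
    then show "onorm (\<lambda>v. v *\<^sub>R f' s) \<le> B" if "s \<in> {-\<bar>t\<bar>..\<bar>t\<bar>}" for s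
      using that assms(2)[of s] by (intro onorm_bound) (auto simp: mult.commute[of B] intro!: mult_left_mono)
  qed auto
  then show ?thesis by simp
qed

text \<open>The squared norm is used because it stays differentiable where \<open>w\<close>
  vanishes: the differential inequality makes
  \<open>exp (- (2 * L * s)) * (w s \<bullet> w s)\<close> nonincreasing. Negative times follow by
  reversing time.\<close>

lemma gronwall_norm:
  fixes w :: "real \<Rightarrow> 'a::real_inner"
  assumes w: "\<And>s. (w has_vector_derivative w' s) (at s)"
    and bound: "\<And>s. norm (w' s) \<le> L * norm (w s)"
  shows "norm (w t) \<le> exp (L * \<bar>t\<bar>) * norm (w 0)"
proof -
  have forward: "norm (v t) \<le> exp (L * t) * norm (v 0)"
    if "0 \<le> t" and v: "\<And>s. (v has_vector_derivative v' s) (at s)"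
      and v': "\<And>s. norm (v' s) \<le> L * norm (v s)" for v v' :: "real \<Rightarrow> 'a" and t
  proof -
    define q where "q s = exp (- (2 * L * s)) * (v s \<bullet> v s)" for s
    have "q t \<le> q 0"
    proof (rule DERIV_nonpos_imp_nonincreasing[OF \<open>0 \<le> t\<close>])
      fix s
      have vs: "((\<lambda>s. v s \<bullet> v s) has_real_derivative 2 * (v s \<bullet> v' s)) (at s)"
        using has_derivative_inner[OF v[of s, unfolded has_vector_derivative_def] v[of s, unfolded has_vector_derivative_def]]
        by (simp add: has_field_derivative_def inner_commute algebra_simps mult_commute_abs)
      have "(q has_real_derivative
          exp (- (2 * L * s)) * (2 * (v s \<bullet> v' s) - 2 * L * (v s \<bullet> v s))) (at s)"
        unfolding q_def by (auto intro!: derivative_eq_intros vs simp: algebra_simps)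
      moreover have "v s \<bullet> v' s \<le> L * (v s \<bullet> v s)"
      proof -
        have "v s \<bullet> v' s \<le> norm (v s) * norm (v' s)" by (rule norm_cauchy_schwarz)
        also have "\<dots> \<le> norm (v s) * (L * norm (v s))" by (intro mult_left_mono v') auto
        finally show ?thesis by (simp add: power2_norm_eq_inner[symmetric] power2_eq_square mult_ac)
      qed
      then have "exp (- (2 * L * s)) * (2 * (v s \<bullet> v' s) - 2 * L * (v s \<bullet> v s)) \<le> 0"
        by (intro mult_nonneg_nonpos) auto
      ultimately show "\<exists>y. (q has_real_derivative y) (at s) \<and> y \<le> 0"
        by blast
    qed
    then have "exp (- (2 * L * t)) * (norm (v t))\<^sup>2 \<le> (norm (v 0))\<^sup>2"
      by (simp add: q_def power2_norm_eq_inner)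
    then have "(norm (v t))\<^sup>2 \<le> exp (2 * L * t) * (norm (v 0))\<^sup>2"
      by (simp add: exp_minus field_simps)
    also have "exp (2 * L * t) = (exp (L * t))\<^sup>2"
      by (simp add: power2_eq_square flip: exp_add)
    finally show ?thesis
      by (simp add: power_mult_distrib[symmetric] power2_le_iff_abs_le)
  qed
  show ?thesis
  proof (cases "0 \<le> t")
    case True
    then show ?thesis using forward[OF True w bound] by simp
  next
    case False
    have "((\<lambda>s. w (- s)) has_vector_derivative - w' (- s)) (at s)" for s
      using vector_diff_chain_at[OF has_vector_derivative_minus[OF has_vector_derivative_id] w[of "- s"]]
      by (simp add: o_def)
    from forward[OF _ this, of "- t"] show ?thesis
      using bound False by simp
  qed
qed

text \<open>The difference is the oriented integral from 0 to \<open>t\<close>, since at most one of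
  the two terms is nonzero. Near \<open>t\<close> it differs by a constant from the integral started
  at \<open>- \<bar>t\<bar> - 1\<close>, so no case distinction on the sign of \<open>t\<close> is
  needed for the derivative.\<close>

lemma has_real_derivative_signed_integral:
  fixes f :: "real \<Rightarrow> real"
  assumes f: "continuous_on UNIV f"
  shows "((\<lambda>t. integral {0..t} f - integral {t..0} f) has_real_derivative f t) (at t)"
proof -
  let ?a = "- \<bar>t\<bar> - 1" and ?b = "\<bar>t\<bar> + 1"
  have int: "f integrable_on {c..e}" for c e
    by (intro integrable_continuous_interval continuous_on_subset[OF f]) auto
  have "((\<lambda>u. integral {?a..u} f - integral {?a..0} f) has_vector_derivative f t - 0) (at t within {?a..?b})"
    by (intro has_vector_derivative_diff has_vector_derivative_const
      integral_has_vector_derivative continuous_on_subset[OF f]) auto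
  then have "((\<lambda>u. integral {?a..u} f - integral {?a..0} f) has_vector_derivative f t) (at t within {?a..?b})"
    by simp
  then have "((\<lambda>u. integral {?a..u} f - integral {?a..0} f) has_vector_derivative f t) (at t within {?a<..<?b})"
    by (rule has_vector_derivative_within_subset) auto
  then have "((\<lambda>u. integral {?a..u} f - integral {?a..0} f) has_vector_derivative f t) (at t)"
    by (subst (asm) at_within_open) auto
  then have "((\<lambda>u. integral {?a..u} f - integral {?a..0} f) has_real_derivative f t) (at t)"
    by (simp add: has_real_derivative_iff_has_vector_derivative)
  then show ?thesis
  proof (rule has_field_derivative_transform_within_open[where S = "{?a<..<?b}"])
    show "integral {?a..u} f - integral {?a..0} f = integral {0..u} f - integral {u..0} f"
      if u: "u \<in> {?a<..<?b}" for u
    proof (cases "0 \<le> u")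
      case True
      have "integral {?a..0} f + integral {0..u} f = integral {?a..u} f"
        using True by (intro Henstock_Kurzweil_Integration.integral_combine int) auto
      then show ?thesis using True by (cases "u = 0") auto
    next
      case False
      have "integral {?a..u} f + integral {u..0} f = integral {?a..0} f"
        using False u by (intro Henstock_Kurzweil_Integration.integral_combine int) auto
      then show ?thesis using False by simp
    qed
  qed auto
qed

lemma exp_diff_le:
  fixes a c m :: real
  assumes "a \<le> m" "c \<le> m"
  shows "\<bar>exp a - exp c\<bar> \<le> exp m * \<bar>a - c\<bar>"
proof -
  have *: "exp y - exp x \<le> exp m * \<bar>y - x\<bar>" if "y \<le> m" for x y :: real
  proof -
    have "exp y * (1 + (x - y)) \<le> exp y * exp (x - y)"
      by (intro mult_left_mono) auto
    then have "exp y - exp x \<le> exp y * (y - x)"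
      by (simp add: algebra_simps flip: exp_add)
    also have "\<dots> \<le> exp y * \<bar>y - x\<bar>"
      by (intro mult_left_mono) auto
    also have "\<dots> \<le> exp m * \<bar>y - x\<bar>"
      using that by (intro mult_right_mono) auto
    finally show ?thesis .
  qed
  show ?thesis using *[OF assms(1), of c] *[OF assms(2), of a] by (auto simp: abs_if)
qed

lemma has_real_derivative_zero_quadratic:
  fixes f :: "real \<Rightarrow> real"
  assumes "\<delta> > 0" and bound: "\<And>h. \<bar>h\<bar> < \<delta> \<Longrightarrow> \<bar>f (t + h) - f t\<bar> \<le> C * h\<^sup>2"
  shows "(f has_real_derivative 0) (at t)"
  unfolding DERIV_def
proof (rule Lim_null_comparison)
  show "\<forall>\<^sub>F h in at 0. norm ((f (t + h) - f t) / h) \<le> C * \<bar>h\<bar>"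
  proof (rule eventually_at_in_open'[THEN eventually_mono])
    show "open {-\<delta><..<\<delta>}" "0 \<in> {-\<delta><..<\<delta>}" using \<open>\<delta> > 0\<close> by auto
  next
    fix h assume h: "h \<in> {-\<delta><..<\<delta>}"
    show "norm ((f (t + h) - f t) / h) \<le> C * \<bar>h\<bar>"
    proof (cases "h = 0")
      case False
      have "\<bar>f (t + h) - f t\<bar> \<le> C * \<bar>h\<bar> * \<bar>h\<bar>"
        using bound[of h] h by (simp add: power2_eq_square abs_less_iff)
      with False show ?thesis by (simp add: pos_divide_le_eq)
    qed simp
  qed
  show "((\<lambda>h. C * \<bar>h\<bar>) \<longlongrightarrow> 0) (at 0)"
    by (auto intro!: tendsto_eq_intros)
qed

lemma abs_integral_le_bounded_support:
  fixes f :: "'a::euclidean_space \<Rightarrow> real"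
  assumes "integrable lborel f" "\<And>x. \<bar>f x\<bar> \<le> B" "\<And>x. norm x > R \<Longrightarrow> f x = 0"
  shows "\<bar>\<integral>x. f x \<partial>lborel\<bar> \<le> B * measure lborel (cball (0::'a) R)"
proof -
  have "norm (\<integral>x. f x \<partial>lborel) \<le> (\<integral>x. B * indicator (cball (0::'a) R) x \<partial>lborel)"
  proof (rule Bochner_Integration.integral_norm_bound_integral)
    show "integrable lborel (\<lambda>x. B * indicator (cball (0::'a) R) x)"
      by (intro integrable_mult_right integrable_real_indicator emeasure_lborel_cball_finite) simp
    show "norm (f x) \<le> B * indicator (cball 0 R) x" for x
      using assms(2)[of x] assms(3)[of x] by (cases "norm x \<le> R") auto
  qed (use assms(1) in auto)
  also have "\<dots> = B * measure lborel (cball (0::'a) R)" by simp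
  finally show ?thesis by simp
qed

section \<open>Flow of a bounded Lipschitz vector field\<close>

text \<open>Lipschitz continuity is the regularity in the initial point that Gronwall's inequality
  yields for the flow, so this class is stable under transport; it also suffices to turn the second
  order error of an Euler step into a second order error of the integral.\<close>

definition lipschitz_bounded_support :: "('a::real_normed_vector \<Rightarrow> real) \<Rightarrow> bool" where
  "lipschitz_bounded_support g \<longleftrightarrow>
    (\<exists>K R. 0 \<le> K \<and> (\<forall>x y. \<bar>g x - g y\<bar> \<le> K * norm (x - y)) \<and> (\<forall>x. norm x > R \<longrightarrow> g x = 0))"

lemma lipschitz_bounded_supportE:
  fixes g :: "'a::euclidean_space \<Rightarrow> real"
  assumes "lipschitz_bounded_support g"
  obtains K B R where "0 \<le> K" "\<And>x y. \<bar>g x - g y\<bar> \<le> K * norm (x - y)" "\<And>x. norm x > R \<Longrightarrow> g x = 0"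
    "0 \<le> B" "\<And>x. \<bar>g x\<bar> \<le> B" "continuous_on UNIV g" "integrable lborel g"
proof -
  from assms obtain K R where K: "0 \<le> K" "\<And>x y. \<bar>g x - g y\<bar> \<le> K * norm (x - y)"
    and R: "\<And>x. norm x > R \<Longrightarrow> g x = 0"
    unfolding lipschitz_bounded_support_def by blast
  have cont: "continuous_on UNIV g"
    using K by (intro lipschitz_on_continuous_on[of K] lipschitz_onI) (auto simp: dist_norm)
  obtain B where "0 \<le> B" "\<And>x. \<bar>g x\<bar> \<le> B"
    using bounded_continuous_bounded_support[OF cont R] by auto
  then show ?thesis
    using that K R cont integrable_continuous_bounded_support[OF cont R] by blast
qed

text \<open>Here \<open>d\<close> is the divergence of \<open>b\<close>; for
  \<open>b = grad u\<close> it is the Laplacian of \<open>u\<close>. Periodicity of the field is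
  replaced by the uniform constants \<open>L\<close>, \<open>M\<close> and \<open>N\<close>.\<close>

locale bounded_flow =
  fixes b :: "real^'n \<Rightarrow> real^'n" and D :: "real^'n \<Rightarrow> real^'n \<Rightarrow> real^'n" and d :: "real^'n \<Rightarrow> real"
    and X :: "real \<Rightarrow> real^'n \<Rightarrow> real^'n" and L M N :: real
  assumes b_der: "(b has_derivative D x) (at x)"
    and D_bdd: "norm (D x v) \<le> L * norm v"
    and b_bdd: "norm (b x) \<le> M"
    and d_eq: "d x = (\<Sum>i\<in>UNIV. D x (axis i 1) $ i)"
    and d_lip: "\<bar>d x - d y\<bar> \<le> N * norm (x - y)"
    and flow0: "X 0 x = x"
    and flow: "((\<lambda>s. X s x) has_vector_derivative b (X t x)) (at t)"
begin

section \<open>Regularity of the field, its flow and the divergence cocycle\<close>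

lemma L_nonneg: "0 \<le> L"
  using order_trans[OF norm_ge_zero D_bdd[of 0 "axis undefined 1"]] by simp

lemma N_nonneg: "0 \<le> N"
  using d_lip[of 0 "axis undefined 1"] by simp

lemma M_nonneg: "0 \<le> M"
  using b_bdd[of 0] norm_ge_zero[of "b 0"] by linarith

text \<open>A bound for the trace, one \<open>L\<close> for each diagonal entry; it is also the
  constant in the smallness condition of \<open>euler_step_integral\<close>.\<close>

definition K :: real where "K = CARD('n) * L"

lemma K_nonneg: "0 \<le> K"
  using L_nonneg by (simp add: K_def)

lemma d_bdd: "\<bar>d x\<bar> \<le> K"
proof -
  have "\<bar>D x (axis i 1) $ i\<bar> \<le> L" for i
    using component_le_norm_cart[of "D x (axis i 1)" i] D_bdd[of x "axis i 1"] by simp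
  then show ?thesis
    unfolding d_eq K_def by (intro order_trans[OF sum_abs] sum_bounded_above) auto
qed

lemma b_lip: "norm (b x - b y) \<le> L * norm (x - y)"
  using b_der D_bdd L_nonneg
  by (intro differentiable_bound[of UNIV b D] onorm_bound) auto

lemma d_cont: "continuous_on UNIV d"
  using d_lip N_nonneg by (intro lipschitz_on_continuous_on[of N] lipschitz_onI) (auto simp: dist_norm)

lemma trajectory_cont: "continuous_on A (\<lambda>s. X s x)"
  using flow by (meson continuous_at_imp_continuous_on has_vector_derivative_continuous)

lemma X_lip: "norm (X t x - X t y) \<le> exp (L * \<bar>t\<bar>) * norm (x - y)"
  using gronwall_norm[of "\<lambda>s. X s x - X s y" "\<lambda>s. b (X s x) - b (X s y)" L t]
  by (simp add: has_vector_derivative_diff flow b_lip flow0)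

lemma X_cont: "continuous_on UNIV (X t)"
  using X_lip by (intro lipschitz_on_continuous_on[of "exp (L * \<bar>t\<bar>)"] lipschitz_onI) (auto simp: dist_norm)

text \<open>The difference of two solutions with the same initial value starts at 0, and Gronwall's
  inequality keeps it there. The group law and the equivariance under translations below both rest
  on this.\<close>

lemma trajectory_unique:
  assumes "\<And>s. (y has_vector_derivative b (y s)) (at s)"
  shows "y t = X t (y 0)"
  using gronwall_norm[of "\<lambda>s. y s - X s (y 0)" "\<lambda>s. b (y s) - b (X s (y 0))" L t]
  by (simp add: has_vector_derivative_diff flow b_lip flow0 assms)

lemma X_add: "X (s + t) x = X s (X t x)"
proof -
  have "((\<lambda>s. X (s + t) x) has_vector_derivative b (X (s + t) x)) (at s)" for s
  proof -
    have "((\<lambda>s. s + t) has_vector_derivative 1) (at s)"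
      unfolding has_vector_derivative_def by (auto intro!: derivative_eq_intros)
    from vector_diff_chain_at[OF this flow[of x "s + t"]] show ?thesis
      by (simp add: o_def)
  qed
  from trajectory_unique[of "\<lambda>s. X (s + t) x", OF this] show ?thesis by simp
qed

lemma X_translate:
  assumes "\<And>x. b (x + k) = b x"
  shows "X t (x + k) = X t x + k"
proof -
  have "((\<lambda>s. X s x + k) has_vector_derivative b (X s x + k)) (at s)" for s
    unfolding assms using flow[of x s] by (auto intro!: derivative_eq_intros)
  from trajectory_unique[of "\<lambda>s. X s x + k", OF this] show ?thesis by (simp add: flow0)
qed

lemma X_near: "norm (X t x - x) \<le> M * \<bar>t\<bar>"
  using increment_bound[of t "\<lambda>s. X s x" "\<lambda>s. b (X s x)" M] by (simp add: flow b_bdd flow0)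

text \<open>After subtracting \<open>s *\<^sub>R b x\<close> the velocity is
  \<open>b (X s x) - b x\<close>, which is of order \<open>t\<close> by the Lipschitz bound for
  \<open>b\<close> and the speed bound \<open>M\<close>.\<close>

lemma X_second_order: "norm (X t x - (x + t *\<^sub>R b x)) \<le> L * M * t\<^sup>2"
proof -
  have "norm ((X t x - t *\<^sub>R b x) - (X 0 x - 0 *\<^sub>R b x)) \<le> (L * (M * \<bar>t\<bar>)) * \<bar>t\<bar>"
  proof (rule increment_bound)
    fix s assume s: "\<bar>s\<bar> \<le> \<bar>t\<bar>"
    show "((\<lambda>s. X s x - s *\<^sub>R b x) has_vector_derivative b (X s x) - b x) (at s)"
      using flow[of x s] by (auto intro!: derivative_eq_intros)
    have "norm (b (X s x) - b x) \<le> L * norm (X s x - x)" by (rule b_lip)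
    also have "\<dots> \<le> L * (M * \<bar>t\<bar>)"
      using X_near[of s x] s M_nonneg L_nonneg
      by (intro mult_left_mono order_trans[OF X_near]) auto
    finally show "norm (b (X s x) - b x) \<le> L * (M * \<bar>t\<bar>)" .
  qed
  then show ?thesis by (simp add: flow0 power2_eq_square algebra_simps)
qed

text \<open>The oriented integral, so that the cocycle identity holds for all real times and not
  only for nonnegative ones.\<close>

definition S :: "real \<Rightarrow> real^'n \<Rightarrow> real" where
  "S t x = integral {0..t} (\<lambda>s. d (X s x)) - integral {t..0} (\<lambda>s. d (X s x))"

lemma S_nonneg_time: "0 \<le> t \<Longrightarrow> S t x = integral {0..t} (\<lambda>s. d (X s x))"
  by (cases "t = 0") (auto simp: S_def)

lemma S_0 [simp]: "S 0 x = 0"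
  by (simp add: S_def)

lemma S_der: "((\<lambda>s. S s x) has_real_derivative d (X t x)) (at t)"
  unfolding S_def
  by (intro has_real_derivative_signed_integral continuous_on_compose2[OF d_cont trajectory_cont]) auto

lemma S_vder: "((\<lambda>s. S s x) has_vector_derivative d (X t x)) (at t)"
  using S_der by (simp add: has_real_derivative_iff_has_vector_derivative)

text \<open>As functions of \<open>s\<close>, both sides have the same derivative by the group law,
  and they agree at \<open>s = 0\<close>.\<close>

lemma S_add: "S (s + t) x = S s (X t x) + S t x"
proof -
  have "((\<lambda>s. S (s + t) x - S s (X t x)) has_real_derivative 0) (at s)" for s
  proof -
    have "((\<lambda>s. S (s + t) x) has_real_derivative d (X (s + t) x)) (at s)"
      using S_der[of x "s + t"] by (simp add: DERIV_shift)
    from DERIV_diff[OF this S_der[of "X t x" s]] show ?thesis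
      by (simp add: X_add)
  qed
  then have "S (s + t) x - S s (X t x) = S (0 + t) x - S 0 (X t x)"
    by (intro DERIV_isconst_all) auto
  then show ?thesis by simp
qed

lemma S_bdd: "\<bar>S t x\<bar> \<le> K * \<bar>t\<bar>"
  using increment_bound[of t "\<lambda>s. S s x" "\<lambda>s. d (X s x)" K] by (simp add: S_vder d_bdd)

lemma S_lip: "\<bar>S t x - S t y\<bar> \<le> N * exp (L * \<bar>t\<bar>) * \<bar>t\<bar> * norm (x - y)"
proof -
  have "norm ((S t x - S t y) - (S 0 x - S 0 y)) \<le> (N * (exp (L * \<bar>t\<bar>) * norm (x - y))) * \<bar>t\<bar>"
  proof (rule increment_bound)
    fix s assume s: "\<bar>s\<bar> \<le> \<bar>t\<bar>"
    show "((\<lambda>s. S s x - S s y) has_vector_derivative d (X s x) - d (X s y)) (at s)"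
      by (intro has_vector_derivative_diff S_vder)
    have "\<bar>d (X s x) - d (X s y)\<bar> \<le> N * norm (X s x - X s y)" by (rule d_lip)
    also have "\<dots> \<le> N * (exp (L * \<bar>t\<bar>) * norm (x - y))"
      using s L_nonneg N_nonneg
      by (intro mult_left_mono order_trans[OF X_lip] mult_right_mono) (auto intro: mult_left_mono)
    finally show "norm (d (X s x) - d (X s y)) \<le> N * (exp (L * \<bar>t\<bar>) * norm (x - y))" by simp
  qed
  then show ?thesis by (simp add: mult_ac)
qed

lemma S_cont: "continuous_on UNIV (S t)"
  using S_lip[of t] N_nonneg
  by (intro lipschitz_on_continuous_on[of "N * exp (L * \<bar>t\<bar>) * \<bar>t\<bar>"] lipschitz_onI) (auto simp: dist_norm)

lemma exp_S_bdd: "exp (S t x) \<le> exp (K * \<bar>t\<bar>)"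
  using S_bdd[of t x] by simp

lemma exp_S_lip: "\<bar>exp (S t x) - exp (S t y)\<bar> \<le> exp (K * \<bar>t\<bar>) * (N * exp (L * \<bar>t\<bar>) * \<bar>t\<bar> * norm (x - y))"
proof -
  have "\<bar>exp (S t x) - exp (S t y)\<bar> \<le> exp (K * \<bar>t\<bar>) * \<bar>S t x - S t y\<bar>"
    using S_bdd[of t x] S_bdd[of t y] by (intro exp_diff_le) auto
  also have "\<dots> \<le> exp (K * \<bar>t\<bar>) * (N * exp (L * \<bar>t\<bar>) * \<bar>t\<bar> * norm (x - y))"
    by (intro mult_left_mono S_lip) auto
  finally show ?thesis .
qed

text \<open>The derivative of \<open>exp (S s x) - s * d x\<close> vanishes at \<open>s = 0\<close>
  and is of order \<open>t\<close>: one part of the constant comes from the weight leaving 1, the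
  other from the point moving while \<open>d\<close> is Lipschitz. The restriction to
  \<open>\<bar>t\<bar> \<le> 1\<close> bounds the weight by \<open>exp K\<close>.\<close>

lemma exp_S_second_order:
  assumes "\<bar>t\<bar> \<le> 1"
  shows "\<bar>exp (S t x) - (1 + t * d x)\<bar> \<le> (exp K * K * K + N * M) * t\<^sup>2"
proof -
  have "norm ((exp (S t x) - t * d x) - (exp (S 0 x) - 0 * d x)) \<le> ((exp K * K * K + N * M) * \<bar>t\<bar>) * \<bar>t\<bar>"
  proof (rule increment_bound)
    fix s assume s: "\<bar>s\<bar> \<le> \<bar>t\<bar>"
    have "((\<lambda>s. exp (S s x) - s * d x) has_real_derivative exp (S s x) * d (X s x) - d x) (at s)"
      by (auto intro!: derivative_eq_intros S_der)
    then show "((\<lambda>s. exp (S s x) - s * d x) has_vector_derivative exp (S s x) * d (X s x) - d x) (at s)"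
      by (simp add: has_real_derivative_iff_has_vector_derivative)
    have Kt: "K * \<bar>s\<bar> \<le> K * \<bar>t\<bar>" "K * \<bar>s\<bar> \<le> K * 1"
      using s assms K_nonneg by (auto intro!: mult_left_mono simp del: mult_1_right)
    have "\<bar>exp (S s x) - exp 0\<bar> \<le> exp K * \<bar>S s x - 0\<bar>"
      using S_bdd[of s x] Kt K_nonneg by (intro exp_diff_le) auto
    also have "\<dots> \<le> exp K * (K * \<bar>t\<bar>)"
      using S_bdd[of s x] Kt by (intro mult_left_mono) auto
    finally have "\<bar>(exp (S s x) - 1) * d (X s x)\<bar> \<le> exp K * (K * \<bar>t\<bar>) * K"
      unfolding abs_mult using d_bdd K_nonneg by (intro mult_mono) auto
    moreover have "\<bar>d (X s x) - d x\<bar> \<le> N * (M * \<bar>t\<bar>)"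
      using s M_nonneg N_nonneg
      by (intro order_trans[OF d_lip] mult_left_mono order_trans[OF X_near]) auto
    moreover have "exp (S s x) * d (X s x) - d x = (exp (S s x) - 1) * d (X s x) + (d (X s x) - d x)"
      by (simp add: algebra_simps)
    ultimately show "norm (exp (S s x) * d (X s x) - d x) \<le> (exp K * K * K + N * M) * \<bar>t\<bar>"
      by (simp only: real_norm_def) (intro order_trans[OF abs_triangle_ineq], simp add: algebra_simps)
  qed
  then show ?thesis by (simp add: power2_eq_square algebra_simps abs_minus_commute)
qed

section \<open>Weighted transport and conservation of the integral\<close>

definition P :: "real \<Rightarrow> (real^'n \<Rightarrow> real) \<Rightarrow> real^'n \<Rightarrow> real" where
  "P t g x = exp (S t x) * g (X t x)"

lemma P_add: "P (t + h) g = P h (P t g)"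
  by (simp add: P_def fun_eq_iff X_add[of t h] S_add[of t h] exp_add mult_ac)

lemma P_0: "P 0 g = g"
  by (simp add: P_def fun_eq_iff flow0)

lemma X_norm_gt: "norm x > R + M * \<bar>t\<bar> \<Longrightarrow> norm (X t x) > R"
  using X_near[of t x] norm_triangle_ineq2[of x "X t x"] by (simp add: norm_minus_commute)

lemma P_lipschitz:
  assumes "lipschitz_bounded_support g"
  shows "lipschitz_bounded_support (P t g)"
proof -
  from assms obtain Kg B R where Kg: "0 \<le> Kg" "\<And>x y. \<bar>g x - g y\<bar> \<le> Kg * norm (x - y)"
    and R: "\<And>x. norm x > R \<Longrightarrow> g x = 0" and B: "0 \<le> B" "\<And>x. \<bar>g x\<bar> \<le> B"
    by (rule lipschitz_bounded_supportE) blast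
  let ?C = "exp (K * \<bar>t\<bar>) * (Kg * exp (L * \<bar>t\<bar>)) + exp (K * \<bar>t\<bar>) * (N * exp (L * \<bar>t\<bar>) * \<bar>t\<bar>) * B"
  have "\<bar>P t g x - P t g y\<bar> \<le> ?C * norm (x - y)" for x y
  proof -
    have "\<bar>exp (S t x) * (g (X t x) - g (X t y))\<bar> \<le> exp (K * \<bar>t\<bar>) * (Kg * (exp (L * \<bar>t\<bar>) * norm (x - y)))"
      unfolding abs_mult using exp_S_bdd[of t x] Kg
      by (intro mult_mono order_trans[OF Kg(2)] mult_left_mono X_lip) auto
    moreover have "\<bar>(exp (S t x) - exp (S t y)) * g (X t y)\<bar>
        \<le> exp (K * \<bar>t\<bar>) * (N * exp (L * \<bar>t\<bar>) * \<bar>t\<bar> * norm (x - y)) * B"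
      unfolding abs_mult using B N_nonneg by (intro mult_mono exp_S_lip) auto
    moreover have "P t g x - P t g y
        = exp (S t x) * (g (X t x) - g (X t y)) + (exp (S t x) - exp (S t y)) * g (X t y)"
      by (simp add: P_def algebra_simps)
    ultimately show ?thesis
      by (simp only:) (intro order_trans[OF abs_triangle_ineq], simp add: algebra_simps)
  qed
  moreover have "0 \<le> ?C"
    using Kg B N_nonneg by simp
  \<comment> \<open>Speed at most \<open>M\<close> enlarges the radius of the support by at most
    \<open>M * \<bar>t\<bar>\<close>.\<close>
  moreover have "P t g x = 0" if "norm x > R + M * \<bar>t\<bar>" for x
    using R[OF X_norm_gt[OF that]] by (simp add: P_def)
  ultimately show ?thesis
    unfolding lipschitz_bounded_support_def by blast
qed

text \<open>The transported function is compared with the Euler integrand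
  \<open>g (x + h *\<^sub>R b x) * (1 + h * d x)\<close>; the two differ by
  \<open>O(h\<^sup>2)\<close> pointwise on a fixed ball, and the Euler integrand is covered by
  \<open>euler_step_integral\<close>.\<close>

lemma P_integral_second_order:
  assumes "lipschitz_bounded_support g"
  shows "\<exists>C. \<forall>h. \<bar>h\<bar> \<le> 1 \<longrightarrow> \<bar>h\<bar> * K < 1 \<longrightarrow>
    \<bar>(\<integral>x. P h g x \<partial>lborel) - (\<integral>x. g x \<partial>lborel)\<bar> \<le> C * h\<^sup>2"
proof -
  from assms obtain Kg B R where Kg: "0 \<le> Kg" "\<And>x y. \<bar>g x - g y\<bar> \<le> Kg * norm (x - y)"
    and R: "\<And>x. norm x > R \<Longrightarrow> g x = 0" and B: "0 \<le> B" "\<And>x. \<bar>g x\<bar> \<le> B"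
    and g_cont: "continuous_on UNIV g"
    by (rule lipschitz_bounded_supportE) blast
  obtain C where C: "\<And>h. \<bar>h\<bar> \<le> 1 \<Longrightarrow> \<bar>h\<bar> * K < 1 \<Longrightarrow>
      \<bar>(\<integral>x. g (x + h *\<^sub>R b x) * (1 + h * d x) \<partial>lborel) - (\<integral>x. g x \<partial>lborel)\<bar> \<le> C * h\<^sup>2"
    using euler_step_integral[OF b_der D_bdd L_nonneg b_bdd d_cont[unfolded d_eq] g_cont R, folded d_eq K_def]
    by blast
  \<comment> \<open>The first summand is the position error seen through the Lipschitz constant of
    \<open>g\<close>, the second is the weight error multiplied by the bound of
    \<open>g\<close>.\<close>
  define C' where "C' = exp K * (Kg * (L * M)) + B * (exp K * K * K + N * M)"
  have b_cont: "continuous_on UNIV b"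
    using b_der by (meson has_derivative_continuous continuous_at_imp_continuous_on)
  have "\<bar>(\<integral>x. P h g x \<partial>lborel) - (\<integral>x. g x \<partial>lborel)\<bar>
      \<le> (C' * measure lborel (cball (0 :: real^'n) (R + M)) + C) * h\<^sup>2"
    if h: "\<bar>h\<bar> \<le> 1" "\<bar>h\<bar> * K < 1" for h
  proof -
    let ?E = "\<lambda>x. g (x + h *\<^sub>R b x) * (1 + h * d x)"
    have Mh: "M * \<bar>h\<bar> \<le> M" using h M_nonneg by (simp add: mult_left_le)
    have supp: "P h g x = 0" "?E x = 0" if "norm x > R + M" for x
    proof -
      show "P h g x = 0"
        unfolding P_def using that Mh by (simp add: R[OF X_norm_gt])
      have "norm (h *\<^sub>R b x) \<le> 1 * M"
        unfolding norm_scaleR using h b_bdd by (intro mult_mono) auto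
      then have "norm (x + h *\<^sub>R b x) > R"
        using that norm_diff_ineq[of x "h *\<^sub>R b x"] by simp
      then show "?E x = 0" by (simp add: R)
    qed
    have E_int: "integrable lborel ?E"
      using supp(2)
      by (intro integrable_continuous_bounded_support[of _ "R + M"] continuous_intros d_cont
          continuous_on_compose2[OF g_cont] b_cont) auto
    obtain P_int: "integrable lborel (P h g)"
      using lipschitz_bounded_supportE[OF P_lipschitz[OF assms]] by metis
    have "\<bar>P h g x - ?E x\<bar> \<le> C' * h\<^sup>2" for x
    proof -
      have "exp (S h x) \<le> exp K"
        using S_bdd[of h x] h K_nonneg mult_left_le[of "\<bar>h\<bar>" K] by auto
      then have "\<bar>exp (S h x) * (g (X h x) - g (x + h *\<^sub>R b x))\<bar> \<le> exp K * (Kg * (L * M * h\<^sup>2))"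
        unfolding abs_mult using Kg
        by (intro mult_mono order_trans[OF Kg(2)] mult_left_mono X_second_order) auto
      moreover have "\<bar>g (x + h *\<^sub>R b x) * (exp (S h x) - (1 + h * d x))\<bar> \<le> B * ((exp K * K * K + N * M) * h\<^sup>2)"
        unfolding abs_mult using B h by (intro mult_mono exp_S_second_order) auto
      moreover have "P h g x - ?E x = exp (S h x) * (g (X h x) - g (x + h *\<^sub>R b x))
          + g (x + h *\<^sub>R b x) * (exp (S h x) - (1 + h * d x))"
        by (simp add: P_def algebra_simps)
      ultimately show ?thesis
        by (simp only:) (intro order_trans[OF abs_triangle_ineq], simp add: C'_def algebra_simps)
    qed
    then have "\<bar>\<integral>x. P h g x - ?E x \<partial>lborel\<bar> \<le> C' * h\<^sup>2 * measure lborel (cball (0 :: real^'n) (R + M))"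
      using supp P_int E_int by (intro abs_integral_le_bounded_support) auto
    then have "\<bar>(\<integral>x. P h g x \<partial>lborel) - (\<integral>x. ?E x \<partial>lborel)\<bar> \<le> C' * h\<^sup>2 * measure lborel (cball (0 :: real^'n) (R + M))"
      using P_int E_int by simp
    with C[OF h] show ?thesis by (simp add: algebra_simps)
  qed
  then show ?thesis by blast
qed

lemma P_integral:
  assumes g: "lipschitz_bounded_support g"
  shows "(\<integral>x. P t g x \<partial>lborel) = (\<integral>x. g x \<partial>lborel)"
proof -
  \<comment> \<open>This choice gives \<open>\<bar>h\<bar> + \<bar>h\<bar> * K < 1\<close> for
    \<open>\<bar>h\<bar> < \<delta>\<close>, hence both smallness conditions at once.\<close>
  define \<delta> where "\<delta> = 1 / (1 + K)"
  have \<delta>: "0 < \<delta>" "\<And>h. \<bar>h\<bar> < \<delta> \<Longrightarrow> \<bar>h\<bar> \<le> 1 \<and> \<bar>h\<bar> * K < 1"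
  proof -
    show "0 < \<delta>" using K_nonneg by (simp add: \<delta>_def)
    fix h :: real assume "\<bar>h\<bar> < \<delta>"
    then have "\<bar>h\<bar> + \<bar>h\<bar> * K < 1"
      using K_nonneg by (simp add: \<delta>_def field_simps)
    then show "\<bar>h\<bar> \<le> 1 \<and> \<bar>h\<bar> * K < 1"
      using K_nonneg mult_nonneg_nonneg[of "\<bar>h\<bar>" K] by linarith
  qed
  have "((\<lambda>t. \<integral>x. P t g x \<partial>lborel) has_real_derivative 0) (at t)" for t
  proof -
    \<comment> \<open>By the group law \<open>P_add\<close>, the estimate near time \<open>t\<close>
      is the estimate near time 0 for the function \<open>P t g\<close>; the constant may depend on
      \<open>t\<close>.\<close>
    obtain C where "\<And>h. \<bar>h\<bar> \<le> 1 \<Longrightarrow> \<bar>h\<bar> * K < 1 \<Longrightarrow>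
      \<bar>(\<integral>x. P h (P t g) x \<partial>lborel) - (\<integral>x. P t g x \<partial>lborel)\<bar> \<le> C * h\<^sup>2"
      using P_integral_second_order[OF P_lipschitz[OF g]] by blast
    then show ?thesis
      using \<delta> by (intro has_real_derivative_zero_quadratic[of \<delta>]) (auto simp: P_add)
  qed
  then have "(\<integral>x. P t g x \<partial>lborel) = (\<integral>x. P 0 g x \<partial>lborel)"
    by (intro DERIV_isconst_all) auto
  then show ?thesis by (simp add: P_0)
qed

section \<open>Liouville's theorem as an identity of measures\<close>

lemma X_measurable [measurable]: "X t \<in> borel_measurable borel"
  by (rule borel_measurable_continuous_onI[OF X_cont])

lemma S_measurable [measurable]: "S t \<in> borel_measurable borel"
  by (rule borel_measurable_continuous_onI[OF S_cont])

text \<open>The indicator of the open box is the pointwise limit of the Lipschitz functions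
  \<open>min 1 (n * dist)\<close>, with \<open>dist\<close> the distance to the complement;
  \<open>P_integral\<close> applies to each of them and dominated convergence passes to the limit on
  both sides.\<close>

lemma weighted_integral_box:
  fixes l u :: "real^'n"
  shows "(\<integral>x. exp (S t x) * indicator (box l u) (X t x) \<partial>lborel) = measure lborel (box l u)"
    and "integrable lborel (\<lambda>x. exp (S t x) * indicator (box l u) (X t x))"
proof -
  define U where "U = box l u"
  define g where "g n x = min 1 (real n * infdist x (- U))" for n x
  obtain R where R: "U \<subseteq> cball 0 R"
    unfolding U_def using bounded_box[of l u] by (auto simp: bounded_iff subset_iff)
  \<comment> \<open>The distance \<open>infdist\<close> to the empty set is 0 by convention, so
    positivity inside the box requires a nonempty complement.\<close>
  have U_nonempty: "- U \<noteq> {}"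
    using not_bounded_UNIV bounded_box[of l u] by (metis U_def Compl_empty_eq double_complement)
  have g_supp: "g n x = 0" if "x \<notin> U" for n x
    using that by (simp add: g_def)
  have g_range: "0 \<le> g n x" "g n x \<le> 1" for n x
    by (auto simp: g_def infdist_nonneg)
  have g_lim: "(\<lambda>n. g n x) \<longlonglongrightarrow> indicator U x" for x
  proof (cases "x \<in> U")
    case True
    have "0 < infdist x (- U)"
      using True U_nonempty by (intro infdist_pos_not_in_closed) (auto simp: U_def open_box)
    then obtain m where m: "1 < real m * infdist x (- U)"
      using reals_Archimedean3 by blast
    have "g n x = 1" if "n \<ge> m" for n
    proof -
      have "real m * infdist x (- U) \<le> real n * infdist x (- U)"
        using that infdist_nonneg by (intro mult_right_mono) auto
      with m show ?thesis by (simp add: g_def)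
    qed
    then show ?thesis
      using True by (intro tendsto_eventually eventually_sequentiallyI[of m]) simp
  qed (simp add: g_supp)
  have g_lip: "lipschitz_bounded_support (g n)" for n
  proof -
    have "\<bar>g n x - g n y\<bar> \<le> real n * norm (x - y)" for x y
    proof -
      have "\<bar>g n x - g n y\<bar> \<le> \<bar>real n * infdist x (- U) - real n * infdist y (- U)\<bar>"
        unfolding g_def by (simp add: min_def)
      also have "\<dots> = real n * \<bar>infdist x (- U) - infdist y (- U)\<bar>"
        by (simp add: abs_mult flip: right_diff_distrib)
      also have "\<dots> \<le> real n * norm (x - y)"
        using infdist_triangle_abs[of x "- U" y] by (intro mult_left_mono) (auto simp: dist_norm)
      finally show ?thesis .
    qed
    moreover have "g n x = 0" if "norm x > R" for x
      using that R by (intro g_supp) force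
    ultimately show ?thesis
      unfolding lipschitz_bounded_support_def by (intro exI[of _ "real n"] exI[of _ R]) auto
  qed
  have [measurable]: "g n \<in> borel_measurable borel" for n
    using g_lip lipschitz_bounded_supportE borel_measurable_continuous_onI by metis
  have [measurable]: "U \<in> sets borel"
    by (simp add: U_def)
  \<comment> \<open>This dominating function combines the bound for the weight with a ball outside
    of which the flow at time \<open>t\<close> cannot reach the box.\<close>
  have w_int: "integrable lborel (\<lambda>x. exp (K * \<bar>t\<bar>) * indicator (cball (0 :: real^'n) (R + M * \<bar>t\<bar>)) x)"
    by (intro integrable_mult_right integrable_real_indicator emeasure_lborel_cball_finite) simp
  have w_bound: "norm (exp (S t x) * g n (X t x)) \<le> exp (K * \<bar>t\<bar>) * indicator (cball 0 (R + M * \<bar>t\<bar>)) x" for n x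
  proof (cases "norm x > R + M * \<bar>t\<bar>")
    case True
    then have "X t x \<notin> U" using X_norm_gt[OF True] R by force
    then show ?thesis by (simp add: g_supp)
  next
    case False
    have "exp (S t x) * \<bar>g n (X t x)\<bar> \<le> exp (K * \<bar>t\<bar>) * 1"
      using exp_S_bdd[of t x] g_range by (intro mult_mono) (auto simp: abs_le_iff order_trans[OF _ g_range(1)])
    with False show ?thesis by (simp add: abs_mult)
  qed
  have lim: "AE x in lborel. (\<lambda>n. exp (S t x) * g n (X t x)) \<longlonglongrightarrow> exp (S t x) * indicator U (X t x)"
    by (intro AE_I2 tendsto_mult tendsto_const g_lim)
  have 1: "(\<lambda>n. \<integral>x. exp (S t x) * g n (X t x) \<partial>lborel) \<longlonglongrightarrow> (\<integral>x. exp (S t x) * indicator U (X t x) \<partial>lborel)"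
    by (rule integral_dominated_convergence[OF _ _ w_int lim AE_I2[OF w_bound]]) measurable
  have "integrable lborel (\<lambda>x. exp (S t x) * indicator U (X t x))"
    by (rule integrable_dominated_convergence[OF _ _ w_int lim AE_I2[OF w_bound]]) measurable
  then show "integrable lborel (\<lambda>x. exp (S t x) * indicator (box l u) (X t x))"
    by (simp add: U_def)
  have U_int: "integrable lborel (indicator U :: real^'n \<Rightarrow> real)"
    unfolding U_def by (intro integrable_real_indicator emeasure_lborel_box_finite) simp
  have 2: "(\<lambda>n. \<integral>x. g n x \<partial>lborel) \<longlonglongrightarrow> (\<integral>x. indicator U x \<partial>lborel)"
  proof (rule integral_dominated_convergence[OF _ _ U_int])
    show "AE x in lborel. norm (g n x) \<le> indicator U x" for n
      using g_range g_supp by (intro AE_I2) (auto simp: indicator_def)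
  qed (measurable, use g_lim in auto)
  have "(\<integral>x. exp (S t x) * g n (X t x) \<partial>lborel) = (\<integral>x. g n x \<partial>lborel)" for n
    using P_integral[where t = t, OF g_lip, of n] by (simp add: P_def)
  with 1 2 have "(\<integral>x. exp (S t x) * indicator U (X t x) \<partial>lborel) = (\<integral>x. indicator U x \<partial>lborel)"
    using LIMSEQ_unique by simp
  then show "(\<integral>x. exp (S t x) * indicator (box l u) (X t x) \<partial>lborel) = measure lborel (box l u)"
    by (simp add: U_def)
qed

text \<open>Agreement on boxes determines the measure, so the preceding lemma suffices.\<close>

theorem liouville:
  "distr (density lborel (\<lambda>x. ennreal (exp (S t x)))) borel (X t) = lborel"
proof (rule lborel_eqI[symmetric])
  fix l u :: "real^'n"
  assume lu: "\<And>b. b \<in> Basis \<Longrightarrow> l \<bullet> b \<le> u \<bullet> b"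
  have "emeasure (distr (density lborel (\<lambda>x. ennreal (exp (S t x)))) borel (X t)) (box l u)
      = emeasure (density lborel (\<lambda>x. ennreal (exp (S t x)))) (X t -` box l u)"
    by (subst emeasure_distr) auto
  also have "\<dots> = (\<integral>\<^sup>+x. ennreal (exp (S t x)) * indicator (X t -` box l u) x \<partial>lborel)"
    by (rule emeasure_density) (auto intro: measurable_sets_borel[OF X_measurable])
  also have "\<dots> = (\<integral>\<^sup>+x. ennreal (exp (S t x) * indicator (box l u) (X t x)) \<partial>lborel)"
    by (intro nn_integral_cong) (auto simp: indicator_def)
  also have "\<dots> = ennreal (measure lborel (box l u))"
    using weighted_integral_box[where t = t and l = l and u = u] by (subst nn_integral_eq_integral) auto
  also have "\<dots> = (\<Prod>b\<in>Basis. (u - l) \<bullet> b)"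
    using lu by (simp add: measure_lborel_box_eq)
  finally show "emeasure (distr (density lborel (\<lambda>x. ennreal (exp (S t x)))) borel (X t)) (box l u)
      = (\<Prod>b\<in>Basis. (u - l) \<bullet> b)" .
qed simp

section \<open>Invariant densities and the weak equation\<close>

lemma integral_flow:
  fixes f :: "real^'n \<Rightarrow> real"
  assumes [measurable]: "f \<in> borel_measurable borel"
  shows "(\<integral>x. exp (S t x) * f (X t x) \<partial>lborel) = (\<integral>x. f x \<partial>lborel)"
proof -
  have "(\<integral>x. f x \<partial>lborel) = (\<integral>x. f x \<partial>distr (density lborel (\<lambda>x. ennreal (exp (S t x)))) borel (X t))"
    by (simp only: liouville)
  also have "\<dots> = (\<integral>x. f (X t x) \<partial>density lborel (\<lambda>x. ennreal (exp (S t x))))"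
    by (rule integral_distr) auto
  also have "\<dots> = (\<integral>x. exp (S t x) * f (X t x) \<partial>lborel)"
    by (subst integral_density) auto
  finally show ?thesis by simp
qed

text \<open>Since \<open>\<sigma>\<close> is only measurable, every derivative falls on the test
  function: \<open>b x \<bullet> G x\<close> is the derivative of \<open>\<phi>\<close> along the
  trajectory at time 0, approximated by difference quotients whose weighted integrals all
  vanish.\<close>

lemma invariant_density_div_free:
  assumes \<sigma>_meas [measurable]: "\<sigma> \<in> borel_measurable borel"
    and \<sigma>_bdd: "\<And>x. \<bar>\<sigma> x\<bar> \<le> B"
    and \<sigma>_flow: "\<And>t x. exp (S t x) * \<sigma> (X t x) = \<sigma> x"
    and \<phi>_der: "\<And>x. (\<phi> has_derivative (\<lambda>v. G x \<bullet> v)) (at x)"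
    and G_cont: "continuous_on UNIV G"
    and G_bdd: "\<And>x. norm (G x) \<le> H"
    and \<phi>_supp: "\<And>x. norm x > R \<Longrightarrow> \<phi> x = 0"
  shows "(\<integral>x. \<sigma> x * (b x \<bullet> G x) \<partial>lborel) = 0"
proof -
  have \<phi>_cont: "continuous_on UNIV \<phi>"
    using \<phi>_der by (meson has_derivative_continuous continuous_at_imp_continuous_on)
  have b_cont: "continuous_on UNIV b"
    using b_der by (meson has_derivative_continuous continuous_at_imp_continuous_on)
  have [measurable]: "\<phi> \<in> borel_measurable borel" "(\<lambda>x. b x \<bullet> G x) \<in> borel_measurable borel"
    by (auto intro!: borel_measurable_continuous_onI \<phi>_cont continuous_intros b_cont G_cont)
  have B: "0 \<le> B" using \<sigma>_bdd[of 0] by linarith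
  have H: "0 \<le> H" using G_bdd[of 0] norm_ge_zero[of "G 0"] by linarith
  have \<phi>_lip: "\<bar>\<phi> x - \<phi> y\<bar> \<le> H * norm (x - y)" for x y
  proof -
    have "norm (\<phi> x - \<phi> y) \<le> H * norm (x - y)"
    proof (rule differentiable_bound[of UNIV \<phi> "\<lambda>x v. G x \<bullet> v"])
      show "onorm (\<lambda>v. G x \<bullet> v) \<le> H" for x
        using H by (intro onorm_bound) (auto intro!: order_trans[OF Cauchy_Schwarz_ineq2] mult_right_mono G_bdd)
    qed (use \<phi>_der in auto)
    then show ?thesis by simp
  qed
  \<comment> \<open>Steps of length at most 1 keep the supports of all difference quotients in the
    ball of radius \<open>R + M\<close>.\<close>
  define h where "h n = 1 / real (Suc n)" for n
  have h: "0 < h n" "h n \<le> 1" for n by (auto simp: h_def)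
  have h_lim: "h \<longlonglongrightarrow> 0"
    unfolding h_def by (rule LIMSEQ_Suc) (rule lim_1_over_n)
  define \<psi> where "\<psi> n x = \<sigma> x * ((\<phi> (X (h n) x) - \<phi> x) / h n)" for n x
  have \<psi>_lim: "(\<lambda>n. \<psi> n x) \<longlonglongrightarrow> \<sigma> x * (b x \<bullet> G x)" for x
  proof -
    have "((\<lambda>t. X t x) has_derivative (\<lambda>s. s *\<^sub>R b x)) (at 0)"
      using flow[of x 0] by (simp add: has_vector_derivative_def flow0)
    from has_derivative_compose[OF this, of \<phi> "\<lambda>v. G x \<bullet> v"] \<phi>_der[of x]
    have "((\<lambda>t. \<phi> (X t x)) has_real_derivative b x \<bullet> G x) (at 0)"
      by (simp add: flow0 has_field_derivative_def inner_commute mult.commute[of _ "G x \<bullet> b x"])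
    then have "((\<lambda>t. (\<phi> (X t x) - \<phi> x) / t) \<longlongrightarrow> b x \<bullet> G x) (at 0)"
      by (simp add: DERIV_def flow0)
    moreover have "filterlim h (at 0) sequentially"
      using h_lim h(1) by (simp add: filterlim_at less_imp_neq[THEN not_sym])
    ultimately have "(\<lambda>n. (\<phi> (X (h n) x) - \<phi> x) / h n) \<longlonglongrightarrow> b x \<bullet> G x"
      by (rule filterlim_compose)
    then show ?thesis
      unfolding \<psi>_def by (intro tendsto_mult tendsto_const)
  qed
  have \<psi>_zero: "(\<integral>x. \<psi> n x \<partial>lborel) = 0" for n
  proof -
    have int: "integrable lborel (\<lambda>x. \<sigma> x * \<phi> (X t x))" for t
    proof (rule Bochner_Integration.integrable_bound)
      show "integrable lborel (\<lambda>x. B * \<phi> (X t x))"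
        using \<phi>_supp[OF X_norm_gt]
        by (intro integrable_mult_right integrable_continuous_bounded_support[of _ "R + M * \<bar>t\<bar>"]
            continuous_on_compose2[OF \<phi>_cont X_cont]) auto
      show "AE x in lborel. norm (\<sigma> x * \<phi> (X t x)) \<le> norm (B * \<phi> (X t x))"
        using \<sigma>_bdd B by (auto simp: abs_mult intro!: mult_right_mono)
    qed measurable
    \<comment> \<open>Writing \<open>\<sigma> x\<close> as
      \<open>exp (S (h n) x) * \<sigma> (X (h n) x)\<close> turns the integrand into the weight
      times a function of the transported point, the form to which Liouville's theorem
      applies.\<close>
    have "(\<integral>x. \<sigma> x * \<phi> (X (h n) x) \<partial>lborel) = (\<integral>x. exp (S (h n) x) * (\<sigma> (X (h n) x) * \<phi> (X (h n) x)) \<partial>lborel)"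
      by (simp add: \<sigma>_flow flip: mult.assoc)
    also have "\<dots> = (\<integral>x. \<sigma> x * \<phi> x \<partial>lborel)"
      by (rule integral_flow) measurable
    finally have "(\<integral>x. \<sigma> x * \<phi> (X (h n) x) - \<sigma> x * \<phi> x \<partial>lborel) = 0"
      using int[of "h n"] int[of 0] by (simp add: flow0)
    moreover have "\<psi> n x = (\<sigma> x * \<phi> (X (h n) x) - \<sigma> x * \<phi> x) / h n" for x
      by (simp add: \<psi>_def algebra_simps)
    ultimately show ?thesis by simp
  qed
  have \<psi>_bdd: "norm (\<psi> n x) \<le> B * (H * M) * indicator (cball 0 (R + M)) x" for n x
  proof (cases "norm x > R + M")
    case True
    have "M * \<bar>h n\<bar> \<le> M" using h[of n] M_nonneg by (simp add: mult_left_le)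
    then have "\<phi> (X (h n) x) = 0" "\<phi> x = 0"
      using True M_nonneg by (auto intro!: \<phi>_supp X_norm_gt)
    then show ?thesis using B H M_nonneg by (simp add: \<psi>_def)
  next
    case False
    have "\<bar>\<phi> (X (h n) x) - \<phi> x\<bar> \<le> H * (M * h n)"
      using X_near[of "h n" x] h(1)[of n] H by (intro order_trans[OF \<phi>_lip] mult_left_mono) auto
    then have "\<bar>(\<phi> (X (h n) x) - \<phi> x) / h n\<bar> \<le> H * M"
      using h(1)[of n] by (simp add: field_simps)
    then have "\<bar>\<psi> n x\<bar> \<le> B * (H * M)"
      unfolding \<psi>_def abs_mult using \<sigma>_bdd B by (intro mult_mono) auto
    with False show ?thesis by simp
  qed
  have "(\<lambda>n. \<integral>x. \<psi> n x \<partial>lborel) \<longlonglongrightarrow> (\<integral>x. \<sigma> x * (b x \<bullet> G x) \<partial>lborel)"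
  proof (rule integral_dominated_convergence)
    show "integrable lborel (\<lambda>x. B * (H * M) * indicator (cball (0::real^'n) (R + M)) x)"
      by (intro integrable_mult_right integrable_real_indicator emeasure_lborel_cball_finite) simp
    show "\<psi> n \<in> borel_measurable lborel" for n
      unfolding \<psi>_def by measurable
  qed (use \<psi>_lim \<psi>_bdd in auto)
  then show ?thesis
    using \<psi>_zero by (simp add: LIMSEQ_const_iff)
qed

section \<open>A bounded primitive of the cocycle\<close>

lemma S_bdd_all_time:
  assumes "\<And>t x. 0 \<le> t \<Longrightarrow> \<bar>S t x\<bar> \<le> C"
  shows "\<bar>S t x\<bar> \<le> C"
proof (cases "0 \<le> t")
  case False
  \<comment> \<open>The total time is 0, so the left side vanishes: the cocycle for negative time
    \<open>t\<close> at \<open>x\<close> is minus the one for the forward time \<open>- t\<close> at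
    \<open>X t x\<close>.\<close>
  have "S (- t + t) x = S (- t) (X t x) + S t x" by (rule S_add)
  then show ?thesis using assms[of "- t" "X t x"] False by simp
qed (rule assms)

text \<open>Along the flow, \<open>S t (X r x)\<close> becomes \<open>S (t + r) x - S r x\<close>; a
  time shift does not change an upper limit at infinity, so only the term \<open>- S r x\<close>
  remains.\<close>

lemma exists_flow_cocycle_primitive:
  assumes "\<And>t x. 0 \<le> t \<Longrightarrow> \<bar>S t x\<bar> \<le> C"
  obtains v where "v \<in> borel_measurable borel" "\<And>x. \<bar>v x\<bar> \<le> C" "\<And>t x. v (X t x) = v x - S t x"
    "\<And>k x. (\<And>x. b (x + k) = b x) \<Longrightarrow> (\<And>x. d (x + k) = d x) \<Longrightarrow> v (x + k) = v x"
proof -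
  have C: "- C \<le> S t x" "S t x \<le> C" for t x
    using S_bdd_all_time[OF assms, of t x] by auto
  \<comment> \<open>The index \<open>s\<close> runs through all reals so that shifting by
    \<open>r\<close> maps the index set onto itself; negative times are covered by the two-sided
    bound just obtained.\<close>
  define m where "m s x = (SUP t\<in>{s..}. S t x)" for s x
  define v where "v x = (INF s. m s x)" for x
  have bdd_S: "bdd_above ((\<lambda>t. S t x) ` A)" for x A
    using C by (intro bdd_aboveI2) auto
  have m_range: "- C \<le> m s x" "m s x \<le> C" for s x
  proof -
    have "S s x \<le> m s x" unfolding m_def by (intro cSUP_upper bdd_S) auto
    with C[of s x] show "- C \<le> m s x" by linarith
    show "m s x \<le> C" unfolding m_def by (intro cSUP_least C) auto
  qed
  have bdd_m: "bdd_below (range (\<lambda>s. m s x))" for x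
    using m_range by (intro bdd_belowI2) auto
  have v_bdd: "\<bar>v x\<bar> \<le> C" for x
  proof -
    have "v x \<le> m 0 x" unfolding v_def by (intro cINF_lower bdd_m) auto
    moreover have "- C \<le> v x" unfolding v_def by (intro cINF_greatest m_range) auto
    ultimately show ?thesis using m_range[of 0 x] by linarith
  qed
  have m_flow: "m s (X r x) = m (s + r) x - S r x" for s r x
  proof (rule antisym)
    have "S t (X r x) \<le> m (s + r) x - S r x" if "s \<le> t" for t
      using that S_add[of t r x] cSUP_upper[OF _ bdd_S, of "t + r" "{s + r..}" x] by (simp add: m_def)
    then show "m s (X r x) \<le> m (s + r) x - S r x"
      unfolding m_def[of s] by (intro cSUP_least) auto
    have "S t x \<le> m s (X r x) + S r x" if "s + r \<le> t" for t
      using that S_add[of "t - r" r x] cSUP_upper[OF _ bdd_S, of "t - r" "{s..}" "X r x"] by (simp add: m_def)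
    then have "m (s + r) x \<le> m s (X r x) + S r x"
      unfolding m_def[of "s + r"] by (intro cSUP_least) auto
    then show "m (s + r) x - S r x \<le> m s (X r x)" by simp
  qed
  have v_flow: "v (X r x) = v x - S r x" for r x
  proof (rule antisym)
    have "v (X r x) + S r x \<le> m s x" for s
      using cINF_lower[OF bdd_m, of "s - r" "X r x"] m_flow[of "s - r" r x] by (simp add: v_def)
    then have "v (X r x) + S r x \<le> v x"
      unfolding v_def[of x] by (intro cINF_greatest) auto
    then show "v (X r x) \<le> v x - S r x" by simp
    have "v x - S r x \<le> m s (X r x)" for s
      using cINF_lower[OF bdd_m, of "s + r" x] m_flow[of s r x] by (simp add: v_def)
    then show "v x - S r x \<le> v (X r x)"
      unfolding v_def[of "X r x"] by (intro cINF_greatest) auto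
  qed
  have "{x. v x < a} \<in> sets borel" for a
  proof -
    \<comment> \<open>The supremum is over uncountably many times, but the superlevel sets are
      unions of open sets, so \<open>m s\<close> is lower semicontinuous and hence Borel.\<close>
    have "{x. a < m s x} = (\<Union>t\<in>{s..}. {x. a < S t x})" for s a
      unfolding m_def by (auto simp: less_cSUP_iff[OF _ bdd_S])
    moreover have "open {x. a < S t x}" for t a
      by (intro open_Collect_less continuous_intros S_cont)
    ultimately have "open {x. a < m s x}" for s a
      by auto
    then have [measurable]: "m s \<in> borel_measurable borel" for s
      by (intro borel_measurable_iff_greater[THEN iffD2]) auto
    \<comment> \<open>Since \<open>m s x\<close> is nonincreasing in \<open>s\<close>, the infimum
      over real \<open>s\<close> is already reached along the natural numbers, which makes the union
      countable.\<close>
    have "{x. v x < a} = (\<Union>n::nat. {x. m (real n) x < a})"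
    proof -
      have "(\<exists>s. m s x < a) \<longleftrightarrow> (\<exists>n::nat. m (real n) x < a)" for x
      proof
        assume "\<exists>s. m s x < a"
        then obtain s where s: "m s x < a" by blast
        obtain n :: nat where n: "s \<le> real n" using real_arch_simple by blast
        have "m (real n) x \<le> m s x"
          unfolding m_def using n by (intro cSUP_subset_mono bdd_S) auto
        with s show "\<exists>n::nat. m (real n) x < a" by (intro exI[of _ n]) linarith
      qed blast
      then show ?thesis
        unfolding v_def by (auto simp: cINF_less_iff[OF _ bdd_m])
    qed
    then show ?thesis by simp
  qed
  then have "v \<in> borel_measurable borel"
    by (intro borel_measurable_iff_less[THEN iffD2]) auto
  moreover have "v (x + k) = v x" if "\<And>x. b (x + k) = b x" "\<And>x. d (x + k) = d x" for k x
    using that by (simp add: v_def m_def S_def X_translate)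
  ultimately show thesis using that v_bdd v_flow by blast
qed

end

section \<open>Periodic functions and gradient fields\<close>

text \<open>The equivalence form is what \<open>frechet_derivative\<close> calls for: it is a choice
  from the set of derivatives, and equal sets give equal choices, also at points where no derivative
  exists.\<close>

lemma has_derivative_periodic_shift:
  fixes f :: "'a::real_normed_vector \<Rightarrow> 'b::real_normed_vector"
  assumes "\<And>y. f (y + k) = f y"
  shows "(f has_derivative f') (at (x + k)) \<longleftrightarrow> (f has_derivative f') (at x)"
proof -
  have shift: "(f has_derivative f') (at x)"
    if "\<And>y. f (y + k) = f y" "(f has_derivative f') (at (x + k))" for x k
  proof -
    have "((\<lambda>y. y + k) has_derivative (\<lambda>v. v)) (at x)"
      by (auto intro!: derivative_eq_intros)
    from has_derivative_compose[OF this that(2)] show ?thesis using that(1) by simp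
  qed
  have "f (y + - k) = f y" for y
    using assms[of "y - k"] by simp
  from shift[of "- k" "x + k", OF this] show ?thesis
    using shift[OF assms, of x] by auto
qed

lemma Y_periodic_partial: "Y_periodic f \<Longrightarrow> Y_periodic (partial i f)"
  unfolding Y_periodic_def partial_def frechet_derivative_def
  using has_derivative_periodic_shift[of f] by simp

section \<open>Gradients and partial derivatives\<close>

lemma has_derivative_grad:
  assumes "f differentiable (at x)"
  shows "(f has_derivative (\<lambda>v. grad f x \<bullet> v)) (at x)"
proof -
  let ?f' = "frechet_derivative f (at x)"
  have f': "(f has_derivative ?f') (at x)"
    using assms frechet_derivative_works by blast
  then have lin: "linear ?f'" by (rule has_derivative_linear)
  have "?f' v = grad f x \<bullet> v" for v
  proof -
    have "?f' v = ?f' (\<Sum>i\<in>UNIV. v $ i *\<^sub>R axis i 1)"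
      by (simp add: basis_expansion[of v, unfolded scalar_mult_eq_scaleR])
    also have "\<dots> = grad f x \<bullet> v"
      by (simp add: linear_sum[OF lin] linear_cmul[OF lin] grad_def partial_def inner_vec_def mult.commute)
    finally show ?thesis .
  qed
  then have "?f' = (\<lambda>v. grad f x \<bullet> v)" by (rule ext)
  with f' show ?thesis by simp
qed

lemma partial_eqI:
  assumes "(f has_derivative f') (at x)"
  shows "partial i f x = f' (axis i 1)"
  using frechet_derivative_at[OF assms] by (simp add: partial_def)

lemma Ck_Suc_continuous: "Ck (Suc k) f \<Longrightarrow> continuous_on UNIV f"
  by (auto intro!: continuous_at_imp_continuous_on differentiable_imp_continuous_within)

lemma Ck_1_grad_continuous: "Ck 1 f \<Longrightarrow> continuous_on UNIV (grad f)"
  unfolding grad_def by (intro continuous_on_vec_lambda) simp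

section \<open>Uniform bounds from periodicity\<close>

lemma Y_periodic_integer_translate:
  assumes "Y_periodic f"
  shows "f (x + (\<chi> i. of_int (k i))) = f x"
proof -
  have nat: "f (x + real n *\<^sub>R axis i 1) = f x" for n i x
  proof (induction n arbitrary: x)
    case (Suc n)
    have "f (x + real (Suc n) *\<^sub>R axis i 1) = f ((x + real n *\<^sub>R axis i 1) + axis i 1)"
      by (simp add: algebra_simps)
    then show ?case using assms Suc by (simp add: Y_periodic_def)
  qed simp
  have int: "f (x + of_int n *\<^sub>R axis i 1) = f x" for n i x
  proof (cases "0 \<le> n")
    case True
    then show ?thesis using nat[of x "nat n" i] by simp
  next
    case False
    \<comment> \<open>For negative \<open>n\<close> the natural-number case is applied at the
      translated point and leads back to \<open>x\<close>.\<close>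
    then show ?thesis using nat[of "x + of_int n *\<^sub>R axis i 1" "nat (- n)" i] by simp
  qed
  have "f (x + (\<Sum>i\<in>I. of_int (k i) *\<^sub>R axis i 1)) = f x" if "finite I" for I
    using that
  proof (induction I arbitrary: x rule: finite_induct)
    case (insert i I)
    then show ?case
      using insert.IH[of "x + of_int (k i) *\<^sub>R axis i 1"] int by (simp add: add.assoc)
  qed simp
  moreover have "(\<Sum>i\<in>UNIV. of_int (k i) *\<^sub>R axis i 1) = (\<chi> i. real_of_int (k i))"
    using basis_expansion[of "\<chi> i. real_of_int (k i)"] by (simp add: scalar_mult_eq_scaleR)
  ultimately show ?thesis by (metis finite)
qed

text \<open>Taking fractional parts of the coordinates moves any point into the compact unit cube
  without changing the value of \<open>f\<close>.\<close>

lemma Y_periodic_continuous_bounded: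
  fixes f :: "real^'n \<Rightarrow> 'b::real_normed_vector"
  assumes per: "Y_periodic f" and cont: "continuous_on UNIV f"
  obtains B where "0 \<le> B" "\<And>x. norm (f x) \<le> B"
proof -
  have "compact (f ` cbox 0 1)"
    by (intro compact_continuous_image compact_cbox continuous_on_subset[OF cont]) auto
  then obtain B where B: "\<And>x. x \<in> cbox 0 1 \<Longrightarrow> norm (f x) \<le> B"
    by (force dest!: compact_imp_bounded simp: bounded_iff)
  have "norm (f x) \<le> B" for x
  proof -
    have "(\<chi> i. frac (x $ i)) \<in> cbox 0 1"
      by (auto simp: mem_box_cart frac_lt_1 less_imp_le)
    moreover have "f (\<chi> i. frac (x $ i)) = f x"
      using Y_periodic_integer_translate[OF per, of x "\<lambda>i. - \<lfloor>x $ i\<rfloor>"]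
      by (simp add: frac_def plus_vec_def)
    ultimately show ?thesis using B by metis
  qed
  moreover from this[of 0] have "0 \<le> B"
    using norm_ge_zero order_trans by blast
  ultimately show ?thesis using that by blast
qed

lemma Ck_1_Y_periodic_lipschitz:
  assumes "Ck 1 f" "Y_periodic f"
  obtains B where "0 \<le> B" "\<And>x. norm (grad f x) \<le> B" "\<And>x y. \<bar>f x - f y\<bar> \<le> B * norm (x - y)"
proof -
  have "Y_periodic (grad f)"
    using Y_periodic_partial[OF assms(2)] by (simp add: Y_periodic_def grad_def)
  then obtain B where B: "0 \<le> B" "\<And>x. norm (grad f x) \<le> B"
    using Y_periodic_continuous_bounded Ck_1_grad_continuous[OF assms(1)] by blast
  have "norm (f x - f y) \<le> B * norm (x - y)" for x y
  proof (rule differentiable_bound[of UNIV f "\<lambda>x v. grad f x \<bullet> v"])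
    show "(f has_derivative (\<lambda>v. grad f x \<bullet> v)) (at x within UNIV)" for x
      using assms(1) by (intro has_derivative_grad) simp
    show "onorm (\<lambda>v. grad f x \<bullet> v) \<le> B" for x
      using B by (intro onorm_bound) (auto intro!: order_trans[OF Cauchy_Schwarz_ineq2] mult_right_mono)
  qed auto
  then show ?thesis using that B by simp
qed

text \<open>Extracts from a test function the data consumed by
  \<open>invariant_density_div_free\<close>. The gradient vanishes off a ball because the function
  is zero on the open complement of that ball, so continuity makes it bounded.\<close>

lemma test_function_regular:
  assumes "test_function \<phi>"
  obtains H R where "\<And>x. (\<phi> has_derivative (\<lambda>v. grad \<phi> x \<bullet> v)) (at x)" "continuous_on UNIV (grad \<phi>)"
    "\<And>x. norm (grad \<phi> x) \<le> H" "\<And>x. norm x > R \<Longrightarrow> \<phi> x = 0"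
proof -
  have C1: "Ck 1 \<phi>" and "bounded (closure {x. \<phi> x \<noteq> 0})"
    using assms by (auto simp: test_function_def smooth_def intro: compact_imp_bounded)
  then have "bounded {x. \<phi> x \<noteq> 0}"
    using closure_subset bounded_subset by blast
  then obtain R where R: "\<And>x. \<phi> x \<noteq> 0 \<Longrightarrow> norm x \<le> R"
    by (auto simp: bounded_iff)
  then have supp: "\<And>x. norm x > R \<Longrightarrow> \<phi> x = 0" by fastforce
  have der: "(\<phi> has_derivative (\<lambda>v. grad \<phi> x \<bullet> v)) (at x)" for x
    using C1 by (intro has_derivative_grad) simp
  have grad_supp: "grad \<phi> x = 0" if "norm x > R" for x
  proof -
    have "((\<lambda>_. 0) has_derivative (\<lambda>_. 0)) (at x)" by simp
    then have "(\<phi> has_derivative (\<lambda>_. 0)) (at x)"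
      by (rule has_derivative_transform_within_open[where s = "{x. norm x > R}"])
        (use that supp in \<open>auto intro!: open_Collect_less continuous_intros\<close>)
    from partial_eqI[OF this] show ?thesis by (simp add: grad_def vec_eq_iff)
  qed
  have cont: "continuous_on UNIV (grad \<phi>)" by (rule Ck_1_grad_continuous[OF C1])
  obtain H where "\<And>x. norm (grad \<phi> x) \<le> H"
    using bounded_continuous_bounded_support[OF cont grad_supp] by blast
  with der cont supp that show ?thesis by blast
qed

section \<open>The gradient field and its flow\<close>

lemma divergence_scaled_grad:
  assumes "\<sigma> differentiable (at x)" "\<And>i. partial i u differentiable (at x)"
  shows "divergence (\<lambda>y. \<sigma> y *\<^sub>R grad u y) x = \<sigma> x * laplacian u x + grad \<sigma> x \<bullet> grad u x"
proof -
  have "partial i (\<lambda>y. \<sigma> y * partial i u y) x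
      = \<sigma> x * partial i (partial i u) x + partial i \<sigma> x * partial i u x" for i
    by (subst partial_eqI[OF has_derivative_mult[OF has_derivative_grad[OF assms(1)] has_derivative_grad[OF assms(2)]]])
      (simp add: grad_def inner_axis)
  then show ?thesis
    by (simp add: divergence_def laplacian_def inner_vec_def grad_def sum.distrib sum_distrib_left)
qed

lemma has_derivative_grad_field:
  fixes u :: "real^'n \<Rightarrow> real"
  assumes "\<And>i. partial i u differentiable (at x)"
  shows "(grad u has_derivative (\<lambda>v. \<chi> i. grad (partial i u) x \<bullet> v)) (at x)"
proof -
  have der: "((\<lambda>y. \<Sum>i\<in>UNIV. partial i u y *\<^sub>R axis i (1::real)) has_derivative
      (\<lambda>v. \<Sum>i\<in>UNIV. (grad (partial i u) x \<bullet> v) *\<^sub>R axis i (1::real))) (at x)"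
    by (intro has_derivative_sum has_derivative_scaleR_left has_derivative_grad assms)
  have sum: "(\<Sum>i\<in>UNIV. c i *\<^sub>R axis i 1) = (\<chi> i. c i)" for c :: "'n \<Rightarrow> real"
    using basis_expansion[of "\<chi> i. c i"] by (simp add: scalar_mult_eq_scaleR)
  have "grad u = (\<lambda>y. \<chi> i. partial i u y)"
    by (simp add: grad_def fun_eq_iff)
  then show ?thesis
    using der unfolding sum by simp
qed

text \<open>Three derivatives of \<open>u\<close> are used: the pure second partials are
  \<open>C\<^sup>1\<close> and periodic, so their gradients are bounded and the Laplacian is
  Lipschitz. Periodicity starts with the first partials, because it is assumed for
  \<open>grad u\<close> and not for \<open>u\<close>.\<close>

lemma bounded_flow_grad:
  fixes u :: "real^'n \<Rightarrow> real"
  assumes u: "Ck 3 u" and per: "Y_periodic (grad u)"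
    and "\<forall>x. X 0 x = x" "\<forall>x t. ((\<lambda>s. X s x) has_vector_derivative grad u (X t x)) (at t)"
  obtains L M N where
    "bounded_flow (grad u) (\<lambda>x v. \<chi> i. grad (partial i u) x \<bullet> v) (laplacian u) X L M N"
proof -
  have C2: "Ck 2 (partial i u)" and C1: "Ck 1 (partial i (partial j u))" for i j
    using u by (simp_all add: numeral_3_eq_3 numeral_2_eq_2)
  have per1: "Y_periodic (partial i u)" for i
    using per by (simp add: Y_periodic_def grad_def vec_eq_iff)
  have "\<exists>B\<ge>0. \<forall>x. norm (grad (partial i u) x) \<le> B" for i
  proof -
    have "Y_periodic (grad (partial i u))"
      using Y_periodic_partial[OF per1] by (simp add: Y_periodic_def grad_def)
    moreover have "continuous_on UNIV (grad (partial i u))"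
      using C2[of i] by (intro Ck_1_grad_continuous) (auto simp: numeral_2_eq_2 intro: Ck_Suc_continuous[of 0])
    ultimately show ?thesis using Y_periodic_continuous_bounded by metis
  qed
  then obtain A where A: "\<And>i. 0 \<le> A i" "\<And>i x. norm (grad (partial i u) x) \<le> A i"
    by metis
  have "\<exists>B\<ge>0. \<forall>x y. \<bar>partial i (partial i u) x - partial i (partial i u) y\<bar> \<le> B * norm (x - y)" for i
    using Ck_1_Y_periodic_lipschitz[OF C1 Y_periodic_partial[OF per1]] by metis
  then obtain Q where Q: "\<And>i x y. \<bar>partial i (partial i u) x - partial i (partial i u) y\<bar> \<le> Q i * norm (x - y)"
    by metis
  have "continuous_on UNIV (grad u)"
    unfolding grad_def using C2
    by (intro continuous_on_vec_lambda) (auto simp: numeral_2_eq_2 intro: Ck_Suc_continuous[of 1])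
  then obtain M where M: "\<And>x. norm (grad u x) \<le> M"
    using Y_periodic_continuous_bounded[OF per] by blast
  have "bounded_flow (grad u) (\<lambda>x v. \<chi> i. grad (partial i u) x \<bullet> v) (laplacian u) X
      (\<Sum>i\<in>UNIV. A i) M (\<Sum>i\<in>UNIV. Q i)"
  proof
    show "(grad u has_derivative (\<lambda>v. \<chi> i. grad (partial i u) x \<bullet> v)) (at x)" for x
      using C2 by (intro has_derivative_grad_field) (simp add: numeral_2_eq_2)
    show "norm (\<chi> i. grad (partial i u) x \<bullet> v) \<le> (\<Sum>i\<in>UNIV. A i) * norm v" for x v
    proof -
      have "\<bar>grad (partial i u) x \<bullet> v\<bar> \<le> A i * norm v" for i
        using A by (intro order_trans[OF Cauchy_Schwarz_ineq2] mult_right_mono) auto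
      then show ?thesis
        unfolding sum_distrib_right by (intro order_trans[OF norm_le_l1_cart] sum_mono) simp
    qed
    show "laplacian u x = (\<Sum>i\<in>UNIV. (\<chi> j. grad (partial j u) x \<bullet> axis i 1) $ i)" for x
      by (simp add: laplacian_def grad_def inner_axis)
    show "\<bar>laplacian u x - laplacian u y\<bar> \<le> (\<Sum>i\<in>UNIV. Q i) * norm (x - y)" for x y
      unfolding laplacian_def sum_subtractf[symmetric] sum_distrib_right
      by (intro order_trans[OF sum_abs] sum_mono Q)
  qed (use M assms in auto)
  then show ?thesis by (rule that)
qed

section \<open>The two implications\<close>

theorem theorem5p2:
  fixes u :: "real^'n \<Rightarrow> real"
    and X :: "real \<Rightarrow> real^'n \<Rightarrow> real^'n"
  assumes dim: "CARD('n) \<ge> 2"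
    and u_C3: "Ck 3 u"
    and grad_per: "Y_periodic (grad u)"
    and flow0: "\<forall>x. X 0 x = x"
    and flow: "\<forall>x t. ((\<lambda>s. X s x) has_vector_derivative grad u (X t x)) (at t)"
    and bdd: "AE x in lborel. bounded {X t x | t. t \<ge> 0} \<or> bounded {X t x | t. t \<le> 0}"
  shows
    "(((\<forall>x. grad u x = 0 \<longrightarrow> laplacian u x = 0) \<and>
      (\<exists>C>0. \<forall>t\<ge>0. \<forall>x. \<bar>integral {0..t} (\<lambda>s. laplacian u (X s x))\<bar> \<le> C))
     \<longrightarrow> (\<exists>\<sigma> :: real^'n \<Rightarrow> real.
            (\<forall>x. \<sigma> x > 0) \<and> Y_periodic \<sigma> \<and> \<sigma> \<in> borel_measurable lborel \<and>
            (\<exists>M. AE x in lborel. \<bar>\<sigma> x\<bar> \<le> M \<and> \<bar>inverse (\<sigma> x)\<bar> \<le> M) \<and>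
            div_free_distrib \<sigma> u)) \<and>
    ((\<exists>\<sigma> :: real^'n \<Rightarrow> real.
        (\<forall>x. \<sigma> x > 0) \<and> Y_periodic \<sigma> \<and> Ck 1 \<sigma> \<and>
        (\<forall>x. divergence (\<lambda>y. \<sigma> y *\<^sub>R grad u y) x = 0))
     \<longrightarrow> ((\<forall>x. grad u x = 0 \<longrightarrow> laplacian u x = 0) \<and>
          (\<exists>C>0. \<forall>t\<ge>0. \<forall>x. \<bar>integral {0..t} (\<lambda>s. laplacian u (X s x))\<bar> \<le> C)))"
proof (intro conjI[of "_ \<longrightarrow> _"] impI)
  assume "(\<forall>x. grad u x = 0 \<longrightarrow> laplacian u x = 0) \<and>
      (\<exists>C>0. \<forall>t\<ge>0. \<forall>x. \<bar>integral {0..t} (\<lambda>s. laplacian u (X s x))\<bar> \<le> C)"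
  then obtain C where C: "\<And>t x. 0 \<le> t \<Longrightarrow> \<bar>integral {0..t} (\<lambda>s. laplacian u (X s x))\<bar> \<le> C"
    by blast
  obtain L M N where
    "bounded_flow (grad u) (\<lambda>x v. \<chi> i. grad (partial i u) x \<bullet> v) (laplacian u) X L M N"
    using bounded_flow_grad[OF u_C3 grad_per flow0 flow] .
  then interpret bounded_flow "grad u" "\<lambda>x v. \<chi> i. grad (partial i u) x \<bullet> v" "laplacian u" X L M N .
  obtain v where v_meas: "v \<in> borel_measurable borel" and v_bdd: "\<And>x. \<bar>v x\<bar> \<le> C"
    and v_flow: "\<And>t x. v (X t x) = v x - S t x"
    and v_per: "\<And>k x. (\<And>x. grad u (x + k) = grad u x) \<Longrightarrow> (\<And>x. laplacian u (x + k) = laplacian u x) \<Longrightarrow> v (x + k) = v x"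
    using exists_flow_cocycle_primitive[of C] C S_nonneg_time by (metis (no_types, lifting))
  \<comment> \<open>With \<open>v (X t x) = v x - S t x\<close>, the exponential satisfies
    \<open>exp (S t x) * \<sigma> (X t x) = \<sigma> x\<close>, and
    \<open>\<bar>v x\<bar> \<le> C\<close> bounds both \<open>\<sigma>\<close> and its inverse by
    \<open>exp C\<close>.\<close>
  define \<sigma> where "\<sigma> x = exp (v x)" for x
  have \<sigma>_meas: "\<sigma> \<in> borel_measurable borel"
    unfolding \<sigma>_def using v_meas by measurable
  have \<sigma>_bdd: "\<bar>\<sigma> x\<bar> \<le> exp C" "\<bar>inverse (\<sigma> x)\<bar> \<le> exp C" for x
    using v_bdd[of x] by (auto simp: \<sigma>_def simp flip: exp_minus)
  have "Y_periodic (laplacian u)"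
  proof -
    have "Y_periodic (partial i u)" for i
      using grad_per by (simp add: Y_periodic_def grad_def vec_eq_iff)
    then have "Y_periodic (partial i (partial i u))" for i
      by (rule Y_periodic_partial)
    then show ?thesis by (simp add: Y_periodic_def laplacian_def)
  qed
  then have "Y_periodic \<sigma>"
    using grad_per v_per by (simp add: Y_periodic_def \<sigma>_def)
  moreover have "div_free_distrib \<sigma> u"
    unfolding div_free_distrib_def
  proof (intro allI impI)
    fix \<phi> :: "real^'n \<Rightarrow> real" assume "test_function \<phi>"
    then show "(\<integral>x. \<sigma> x * (grad u x \<bullet> grad \<phi> x) \<partial>lborel) = 0"
    proof (rule test_function_regular)
      fix H R
      assume "\<And>x. (\<phi> has_derivative (\<lambda>v. grad \<phi> x \<bullet> v)) (at x)" "continuous_on UNIV (grad \<phi>)"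
        "\<And>x. norm (grad \<phi> x) \<le> H" "\<And>x. norm x > R \<Longrightarrow> \<phi> x = 0"
      then show ?thesis
        using \<sigma>_meas \<sigma>_bdd
        by (intro invariant_density_div_free[of \<sigma> "exp C" \<phi> "grad \<phi>" H R])
          (auto simp: \<sigma>_def v_flow simp flip: exp_add)
    qed
  qed
  ultimately show "\<exists>\<sigma> :: real^'n \<Rightarrow> real.
      (\<forall>x. \<sigma> x > 0) \<and> Y_periodic \<sigma> \<and> \<sigma> \<in> borel_measurable lborel \<and>
      (\<exists>M. AE x in lborel. \<bar>\<sigma> x\<bar> \<le> M \<and> \<bar>inverse (\<sigma> x)\<bar> \<le> M) \<and> div_free_distrib \<sigma> u"
    using \<sigma>_meas \<sigma>_bdd by (intro exI[of _ \<sigma>] conjI exI[of _ "exp C"]) (auto simp: \<sigma>_def)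
next
  assume "\<exists>\<sigma> :: real^'n \<Rightarrow> real. (\<forall>x. \<sigma> x > 0) \<and> Y_periodic \<sigma> \<and> Ck 1 \<sigma> \<and>
      (\<forall>x. divergence (\<lambda>y. \<sigma> y *\<^sub>R grad u y) x = 0)"
  then obtain \<sigma> :: "real^'n \<Rightarrow> real" where \<sigma>_pos: "\<And>x. \<sigma> x > 0" and \<sigma>_per: "Y_periodic \<sigma>"
    and \<sigma>_C1: "Ck 1 \<sigma>" and div: "\<And>x. divergence (\<lambda>y. \<sigma> y *\<^sub>R grad u y) x = 0"
    by blast
  have \<sigma>_diff: "\<sigma> differentiable (at x)" for x
    using \<sigma>_C1 by simp
  \<comment> \<open>This expanded form serves both conclusions: at a critical point the second term
    drops out and \<open>\<sigma> x > 0\<close> forces the Laplacian to vanish; divided by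
    \<open>\<sigma>\<close>, it identifies the Laplacian with the derivative of
    \<open>- ln \<sigma>\<close> along trajectories.\<close>
  have eq: "\<sigma> x * laplacian u x + grad \<sigma> x \<bullet> grad u x = 0" for x
    using divergence_scaled_grad[OF \<sigma>_diff, of u x] div[of x] u_C3 by (simp add: numeral_3_eq_3)
  have ln_cont: "continuous_on UNIV (\<lambda>x. ln (\<sigma> x))"
    using \<sigma>_C1 \<sigma>_pos Ck_Suc_continuous[of 0 \<sigma>]
    by (intro continuous_on_ln) (auto simp: less_imp_neq[THEN not_sym])
  have "Y_periodic (\<lambda>x. ln (\<sigma> x))"
    using \<sigma>_per by (simp add: Y_periodic_def)
  then obtain B where B: "0 \<le> B" "\<And>x. \<bar>ln (\<sigma> x)\<bar> \<le> B"
    using Y_periodic_continuous_bounded[OF _ ln_cont] by auto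
  \<comment> \<open>The integral is a difference of two values of \<open>ln \<sigma>\<close>, each
    at most \<open>B\<close> in absolute value; adding 1 makes the constant strictly positive even
    when \<open>B = 0\<close>.\<close>
  have "\<bar>integral {0..t} (\<lambda>s. laplacian u (X s x))\<bar> \<le> 2 * B + 1" if t: "0 \<le> t" for t x
  proof -
    have "((\<lambda>s. laplacian u (X s x)) has_integral (- ln (\<sigma> (X t x)) - - ln (\<sigma> (X 0 x)))) {0..t}"
    proof (rule fundamental_theorem_of_calculus[OF t])
      fix s
      have "((\<lambda>s. X s x) has_derivative (\<lambda>r. r *\<^sub>R grad u (X s x))) (at s)"
        using flow by (simp add: has_vector_derivative_def)
      from has_derivative_compose[OF this has_derivative_grad[OF \<sigma>_diff]]
      have \<sigma>X: "((\<lambda>s. \<sigma> (X s x)) has_real_derivative grad \<sigma> (X s x) \<bullet> grad u (X s x)) (at s)"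
        by (simp add: has_field_derivative_def mult.commute[of _ "grad \<sigma> (X s x) \<bullet> grad u (X s x)"])
      have "((\<lambda>s. - ln (\<sigma> (X s x))) has_real_derivative
          - (grad \<sigma> (X s x) \<bullet> grad u (X s x) / \<sigma> (X s x))) (at s)"
        using \<sigma>X \<sigma>_pos by (auto intro!: derivative_eq_intros simp: divide_inverse mult.commute)
      moreover have "- (grad \<sigma> (X s x) \<bullet> grad u (X s x) / \<sigma> (X s x)) = laplacian u (X s x)"
        using eq[of "X s x"] \<sigma>_pos[of "X s x"] by (simp add: field_simps)
      ultimately show "((\<lambda>s. - ln (\<sigma> (X s x))) has_vector_derivative laplacian u (X s x)) (at s within {0..t})"
        by (simp add: has_real_derivative_iff_has_vector_derivative has_vector_derivative_at_within)
    qed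
    then show ?thesis
      using B(2)[of "X t x"] B(2)[of "X 0 x"] by (simp add: integral_unique)
  qed
  moreover have "laplacian u x = 0" if "grad u x = 0" for x
    using eq[of x] \<sigma>_pos[of x] that by simp
  ultimately show "(\<forall>x. grad u x = 0 \<longrightarrow> laplacian u x = 0) \<and>
      (\<exists>C>0. \<forall>t\<ge>0. \<forall>x. \<bar>integral {0..t} (\<lambda>s. laplacian u (X s x))\<bar> \<le> C)"
    using B(1) by (intro conjI exI[of _ "2 * B + 1"]) auto
qed

end
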